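(* Let $\beta(\sigma)$ denote the number of occurrences of the arrow pattern $\beta=(12;1\to2)$ in a permutation $\sigma$, let $\mathfrak{S}_n(321)$ be the set of permutations in $\mathfrak{S}_n$ avoiding the classical pattern $321$, and let $\mathrm{Dyck}_n$ be the set of Dyck paths of semilength $n$. For every $n\ge1$, the mapping $\Psi:=\mathrm{rev}\circ\Psi_{\mathrm{K}}:\mathfrak{S}_n(321)\to\mathrm{Dyck}_n$ is a bijection such that for every $\sigma\in\mathfrak{S}_n(321)$, $$\beta(\sigma)=\mathsf{tu}(\Psi(\sigma)),$$ where $\mathsf{tu}(w)$ is the number of occurrences of three consecutive up steps in $w$. In particular, $$a_n(321,\beta)=|\{w\in\mathrm{Dyck}_n:\mathsf{tu}(w)=0\}|=M_n,$$ where $a_n(321,\beta)$ is the number of permutations in $\mathfrak{S}_n$ that avoid both $321$ and the arrow pattern $\beta$, and $M_n$ is the $n$-th Motzkin number.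
   Context: $\mathfrak{S}_n$ is the set of permutations of $[n]=\{1,\dots,n\}$, written in one-line notation $\sigma=\sigma_1\cdots\sigma_n$ with $\sigma_i=\sigma(i)$. A permutation $\sigma\in\mathfrak{S}_n$ contains the classical pattern $\pi\in\mathfrak{S}_m$ if there are $1\le i_1<\cdots<i_m\le n$ such that $\sigma_{i_1}\cdots\sigma_{i_m}$ is order-isomorphic to $\pi$; otherwise it avoids $\pi$. Standard cycle notation: every cycle (including fixed points) is written as $(a\ \sigma(a)\ \sigma^2(a)\cdots)$ beginning with its maximal element $a$, and the cycles are listed from left to right in increasing order of their maximal elements. The bijection $\Phi:\mathfrak{S}_n\to\mathfrak{S}_n$ sends $\sigma$ to the permutation whose one-line notation is obtained by erasing the parentheses in the standard cycle notation of $\sigma$. For $\sigma\in\mathfrak{S}_n$ write $\hat\sigma=\Phi^{-1}(\sigma)$. An arrow pattern of size $k$ is a pair $(\nu;H)$ with $\nu=a_1\ldots a_m$ a string of positive integers and $H=\{b_i\to c_i:1\le i\le h\}$ a (possibly empty) set of arrows, such that the distinct integers appearing in $\nu$ or $H$ form $[k]$. An occurrence of $(\nu;H)$ in $\sigma\in\mathfrak{S}_n$ is a subset $X=\{x_1<\cdots<x_k\}\subseteq[n]$ such that (1) $\sigma_{t_1}\cdots\sigma_{t_m}=x_{a_1}\cdots x_{a_m}$ for some indices $t_1<\cdots<t_m$, and (2) $\hat\sigma(x_{b_i})=x_{c_i}$ for all $1\le i\le h$; $\sigma$ avoids the arrow pattern if it has no occurrence. In particular, $\beta(\sigma)$ is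 the number of pairs $x_1<x_2$ in $[n]$ such that $x_1$ appears to the left of $x_2$ in the one-line notation of $\sigma$ and $\hat\sigma(x_1)=x_2$. A Motzkin path of length $n$ is a lattice path from $(0,0)$ to $(n,0)$ never falling below the $x$-axis, with up steps $\mathrm{U}=(1,1)$, down steps $\mathrm{D}=(1,-1)$ and level steps $\mathrm{L}=(1,0)$; $M_n$ is the number of these (OEIS A001006). A Dyck path of semilength $n$ is a Motzkin path of length $2n$ without level steps. Paths are written as words in their steps; $\mathsf{tu}(w)$ counts the positions $i$ with $w_iw_{i+1}w_{i+2}=\mathrm{UUU}$. $\mathrm{rev}(w)$ is the Dyck path obtained by reversing $w$, i.e. reading the word $w$ from right to left and exchanging $\mathrm{U}$ and $\mathrm{D}$. Krattenthaler's map $\Psi_{\mathrm{K}}:\mathfrak{S}_n(321)\to\mathrm{Dyck}_n$: let $m_1=\sigma_1<m_2<\cdots<m_k=n$ be the left-to-right maxima of $\sigma$ (entries larger than all entries to their left), and write uniquely $\sigma=m_1v_1m_2v_2\cdots m_kv_k$ with $v_i$ (possibly empty) subwords, of length $|v_i|$. Then, with $m_0:=0$, $$\Psi_{\mathrm{K}}(\sigma)=\mathrm{U}^{m_1-m_0}\mathrm{D}^{|v_1|+1}\mathrm{U}^{m_2-m_1}\mathrm{D}^{|v_2|+1}\cdots\mathrm{U}^{m_k-m_{k-1}}\mathrm{D}^{|v_k|+1}.$$ *)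

theory Defs
  imports "HOL-Combinatorics.Combinatorics"
begin

section \<open>Permutations and classical patterns\<close>

text \<open>A permutation of $[n]$ is a function on \<^typ>\<open>nat\<close> that permutes \<open>{1..n}\<close> (and so
  fixes every other number). Patterns are given by their one-line notation.\<close>

definition perms :: "nat \<Rightarrow> (nat \<Rightarrow> nat) set" where
  "perms n = {\<sigma>. \<sigma> permutes {1..n}}"

definition contains_pattern :: "nat \<Rightarrow> (nat \<Rightarrow> nat) \<Rightarrow> nat list \<Rightarrow> bool" where
  "contains_pattern n \<sigma> \<pi> \<longleftrightarrow>
     (\<exists>is. length is = length \<pi> \<and> sorted_wrt (<) is \<and> set is \<subseteq> {1..n} \<and>
       (\<forall>p<length \<pi>. \<forall>q<length \<pi>. \<sigma> (is ! p) < \<sigma> (is ! q) \<longleftrightarrow> \<pi> ! p < \<pi> ! q))"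

definition perms_avoiding_321 :: "nat \<Rightarrow> (nat \<Rightarrow> nat) set" where
  "perms_avoiding_321 n = {\<sigma> \<in> perms n. \<not> contains_pattern n \<sigma> [3, 2, 1]}"


section \<open>Standard cycle notation and arrow patterns\<close>

text \<open>The library's \<open>support \<sigma> a\<close> is the cycle \<open>[a, \<sigma> a, \<sigma> (\<sigma> a), \<dots>]\<close> of \<open>\<sigma>\<close>
  starting at \<open>a\<close>.\<close>

definition cycle_maxima :: "nat \<Rightarrow> (nat \<Rightarrow> nat) \<Rightarrow> nat set" where
  "cycle_maxima n \<sigma> = {a \<in> {1..n}. \<forall>b \<in> set (support \<sigma> a). b \<le> a}"

definition standard_cycles :: "nat \<Rightarrow> (nat \<Rightarrow> nat) \<Rightarrow> nat list list" where
  "standard_cycles n \<sigma> = map (support \<sigma>) (sorted_list_of_set (cycle_maxima n \<sigma>))"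

definition Phi :: "nat \<Rightarrow> (nat \<Rightarrow> nat) \<Rightarrow> (nat \<Rightarrow> nat)" where
  "Phi n \<sigma> = (\<lambda>i. if i \<in> {1..n} then concat (standard_cycles n \<sigma>) ! (i - 1) else i)"

definition hat :: "nat \<Rightarrow> (nat \<Rightarrow> nat) \<Rightarrow> (nat \<Rightarrow> nat)" where
  "hat n \<sigma> = inv_into (perms n) (Phi n) \<sigma>"

text \<open>An arrow pattern $(\nu;H)$ is a pair of the string \<open>\<nu>\<close> and the set of arrows
  \<open>(b, c)\<close>, standing for $b \to c$.\<close>

type_synonym arrow_pattern = "nat list \<times> (nat \<times> nat) set"

definition letters :: "arrow_pattern \<Rightarrow> nat set" where
  "letters P = set (fst P) \<union> fst ` snd P \<union> snd ` snd P"

text \<open>Well-formedness of an arrow pattern, \<open>letters P = {1..k}\<close>, is not imposed by the type; the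
  following notions are meant for patterns satisfying it, whose size is then \<open>card (letters P)\<close>.
  The element $x_a$ of \<open>X\<close> is \<open>sorted_list_of_set X ! (a - 1)\<close>.\<close>

definition arrow_occurrence :: "nat \<Rightarrow> (nat \<Rightarrow> nat) \<Rightarrow> arrow_pattern \<Rightarrow> nat set \<Rightarrow> bool" where
  "arrow_occurrence n \<sigma> P X \<longleftrightarrow>
     X \<subseteq> {1..n} \<and> card X = card (letters P) \<and>
     (let x = (\<lambda>a. sorted_list_of_set X ! (a - 1)) in
        (\<exists>ts. sorted_wrt (<) ts \<and> set ts \<subseteq> {1..n} \<and> map \<sigma> ts = map x (fst P)) \<and>
        (\<forall>(b, c) \<in> snd P. hat n \<sigma> (x b) = x c))"

definition arrow_count :: "nat \<Rightarrow> arrow_pattern \<Rightarrow> (nat \<Rightarrow> nat) \<Rightarrow> nat" where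
  "arrow_count n P \<sigma> = card {X. arrow_occurrence n \<sigma> P X}"

definition avoids_arrow :: "nat \<Rightarrow> arrow_pattern \<Rightarrow> (nat \<Rightarrow> nat) \<Rightarrow> bool" where
  "avoids_arrow n P \<sigma> \<longleftrightarrow> (\<nexists>X. arrow_occurrence n \<sigma> P X)"

definition beta_pattern :: arrow_pattern where
  "beta_pattern = ([1, 2], {(1, 2)})"


section \<open>Motzkin and Dyck paths\<close>

datatype step = U | D | L

fun rise :: "step \<Rightarrow> int" where
  "rise U = 1"
| "rise D = -1"
| "rise L = 0"

definition height :: "step list \<Rightarrow> int" where
  "height w = sum_list (map rise w)"

definition motzkin_paths :: "nat \<Rightarrow> step list set" where
  "motzkin_paths n = {w. length w = n \<and> height w = 0 \<and> (\<forall>i\<le>n. 0 \<le> height (take i w))}"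

definition motzkin_number :: "nat \<Rightarrow> nat" where
  "motzkin_number n = card (motzkin_paths n)"

definition dyck_paths :: "nat \<Rightarrow> step list set" where
  "dyck_paths n = {w \<in> motzkin_paths (2 * n). L \<notin> set w}"

definition tu :: "step list \<Rightarrow> nat" where
  "tu w = card {i. i + 2 < length w \<and> w ! i = U \<and> w ! (i + 1) = U \<and> w ! (i + 2) = U}"

fun swap_step :: "step \<Rightarrow> step" where
  "swap_step U = D"
| "swap_step D = U"
| "swap_step L = L"

definition rev_path :: "step list \<Rightarrow> step list" where
  "rev_path w = map swap_step (rev w)"


section \<open>Krattenthaler's map\<close>

definition lr_max_positions :: "nat \<Rightarrow> (nat \<Rightarrow> nat) \<Rightarrow> nat list" where
  "lr_max_positions n \<sigma> = filter (\<lambda>i. \<forall>j\<in>{1..<i}. \<sigma> j < \<sigma> i) [1..<n + 1]"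

text \<open>In $\sigma = m_1 v_1 m_2 v_2 \cdots m_k v_k$, \<open>lr_max n \<sigma> i\<close> is
  $m_i$ (with $m_0 = 0$) and \<open>lr_subword n \<sigma> i\<close> is $v_i$, for $1 \le i \le k$, where $k$ is the length
  of \<open>lr_max_positions n \<sigma>\<close>. The list itself is indexed from \<open>0\<close>.\<close>

definition lr_max :: "nat \<Rightarrow> (nat \<Rightarrow> nat) \<Rightarrow> nat \<Rightarrow> nat" where
  "lr_max n \<sigma> i = (if i = 0 then 0 else \<sigma> (lr_max_positions n \<sigma> ! (i - 1)))"

definition lr_subword :: "nat \<Rightarrow> (nat \<Rightarrow> nat) \<Rightarrow> nat \<Rightarrow> nat list" where
  "lr_subword n \<sigma> i =
     (let ps = lr_max_positions n \<sigma>;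
          next_pos = (if i < length ps then ps ! i else n + 1)
      in map \<sigma> [ps ! (i - 1) + 1..<next_pos])"

definition Psi_K :: "nat \<Rightarrow> (nat \<Rightarrow> nat) \<Rightarrow> step list" where
  "Psi_K n \<sigma> =
     concat (map (\<lambda>i. replicate (lr_max n \<sigma> i - lr_max n \<sigma> (i - 1)) U @
                      replicate (length (lr_subword n \<sigma> i) + 1) D)
                 [1..<length (lr_max_positions n \<sigma>) + 1])"

definition Psi :: "nat \<Rightarrow> (nat \<Rightarrow> nat) \<Rightarrow> step list" where
  "Psi n = rev_path \<circ> Psi_K n"

end

theory Submission
  imports Defs "HOL-Library.Infinite_Set"
begin

text \<open>
  Everything is read off the running maxima $M_j = \max(\sigma_1, \dots, \sigma_j)$ and their
  increments $a_j = M_j - M_{j-1}$, the list \<open>jumps n \<sigma>\<close>. Position $j$ holds a left-to-right maximum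
  exactly when $a_j > 0$, so Krattenthaler's word is
  $\mathrm{U}^{a_1}\mathrm{D}\,\mathrm{U}^{a_2}\mathrm{D} \cdots \mathrm{U}^{a_n}\mathrm{D}$
  (\<open>Psi_K_eq_block_path_jumps\<close>), one down step per position.

  \<^bold>\<open>Bijectivity.\<close> A word of this shape is a Dyck path exactly when the partial sums of $a$ satisfy
  $a_1 + \dots + a_j \ge j$, with equality for $j = n$ (\<open>bij_betw_block_path\<close>). In a permutation avoiding
  321 the entries that are not left-to-right maxima increase from left to right, so the running
  maxima determine the permutation (\<open>inj_on_jumps\<close>). Conversely, any such $a$ is realised by
  placing the prescribed maxima and filling the other positions with the other values in increasing
  order; a count shows that each filler stays below the running maximum (\<open>ex_perm_with_jumps\<close>).

  \<^bold>\<open>The statistic.\<close> The left-to-right maxima of $\sigma$ are the points where the cycles of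
  $\hat\sigma$ begin, which amounts to $\hat\sigma(\sigma_i) = \min(\sigma_{i+1}, M_i)$ with
  $\sigma_{n+1} = n + 1$ (\<open>hat_successor\<close>). The value $M_i$ occurs at or before position $i$, so the
  occurrences of $\beta$ are the $i$ with $\sigma_i < \sigma_{i+1} < M_i$. For permutations avoiding 321
  this says that neither $i$ nor $i+1$ holds a left-to-right maximum, that is $a_i = a_{i+1} = 0$
  (\<open>arrow_count_beta\<close>). Since $a_1 > 0$, two consecutive zeros correspond to a factor DDD of the
  word and hence to UUU in the reversed path (\<open>tu_rev_path_block_path\<close>).

  \<^bold>\<open>Motzkin numbers.\<close> A Dyck path $\mathrm{U}^{a_1}\mathrm{D} \cdots \mathrm{U}^{a_n}\mathrm{D}$ has no UUU
  exactly when all $a_j \le 2$. Replacing $\mathrm{U}^{a_j}\mathrm{D}$ by a single step of rise $a_j - 1$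
  then turns the condition on the partial sums of $a$ into the condition for a Motzkin path of
  length $n$ (\<open>card_tu_free_eq_motzkin\<close>).
\<close>

section \<open>Dyck paths and the lengths of their ascents\<close>

definition block_path :: "nat list \<Rightarrow> step list" where
  "block_path a = concat (map (\<lambda>k. replicate k U @ [D]) a)"

definition ballot :: "nat \<Rightarrow> nat list set" where
  "ballot n = {a. length a = n \<and> sum_list a = n \<and> (\<forall>j\<le>n. j \<le> sum_list (take j a))}"

lemma block_path_simps [simp]:
  "block_path [] = []"
  "block_path (k # a) = replicate k U @ D # block_path a"
  "block_path (a @ b) = block_path a @ block_path b"
  by (simp_all add: block_path_def)

lemma height_simps [simp]:
  "height [] = 0"
  "height (x # w) = rise x + height w"
  "height (v @ w) = height v + height w"
  by (simp_all add: height_def)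

lemma height_replicate_U [simp]: "height (replicate k U) = int k"
  by (induction k) simp_all

lemma height_block_path: "height (block_path a) = int (sum_list a) - int (length a)"
  by (induction a) simp_all

lemma length_block_path: "length (block_path a) = sum_list a + length a"
  by (induction a) simp_all

lemma L_notin_block_path: "L \<notin> set (block_path a)"
  by (induction a) auto

text \<open>The starting height is a parameter so that the condition can be peeled off one step at a time.\<close>

definition nonneg_from :: "int \<Rightarrow> step list \<Rightarrow> bool" where
  "nonneg_from h w \<longleftrightarrow> (\<forall>i\<le>length w. 0 \<le> h + height (take i w))"

lemma all_le_Suc_iff: "(\<forall>i\<le>Suc n. P i) \<longleftrightarrow> P 0 \<and> (\<forall>i\<le>n. P (Suc i))"
  by (metis Suc_le_mono not0_implies_Suc zero_le)

lemma nonneg_from_simps [simp]: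
  "nonneg_from h [] \<longleftrightarrow> 0 \<le> h"
  "nonneg_from h (x # w) \<longleftrightarrow> 0 \<le> h \<and> nonneg_from (h + rise x) w"
  by (simp_all add: nonneg_from_def all_le_Suc_iff add.assoc)

lemma nonneg_from_nonneg: "nonneg_from h w \<Longrightarrow> 0 \<le> h"
  by (cases w) auto

lemma nonneg_from_replicate_U:
  "nonneg_from h (replicate k U @ w) \<longleftrightarrow> 0 \<le> h \<and> nonneg_from (h + int k) w"
proof (induction k arbitrary: h)
  case 0
  then show ?case using nonneg_from_nonneg by auto
next
  case (Suc k)
  have "h + rise U + int k = h + int (Suc k)" by simp
  moreover have "0 \<le> h + rise U" if "0 \<le> h" using that by simp
  ultimately show ?case
    using Suc.IH[of "h + rise U"] by (metis append_Cons nonneg_from_simps(2) replicate_Suc)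
qed

definition ballot_from :: "int \<Rightarrow> nat list \<Rightarrow> bool" where
  "ballot_from h a \<longleftrightarrow> (\<forall>j\<le>length a. int j \<le> h + int (sum_list (take j a)))"

lemma ballot_from_simps [simp]:
  "ballot_from h [] \<longleftrightarrow> 0 \<le> h"
  "ballot_from h (k # a) \<longleftrightarrow> 0 \<le> h \<and> ballot_from (h + (int k - 1)) a"
proof -
  have "int (Suc j) \<le> h + int (sum_list (take (Suc j) (k # a))) \<longleftrightarrow>
      int j \<le> h + (int k - 1) + int (sum_list (take j a))" for j
    by simp linarith
  then show "ballot_from h (k # a) \<longleftrightarrow> 0 \<le> h \<and> ballot_from (h + (int k - 1)) a"
    unfolding ballot_from_def list.size(4) add_Suc_right add_0_right all_le_Suc_iff by simp
qed (simp add: ballot_from_def)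

text \<open>Within one block \<open>U\<^sup>k D\<close> the path is lowest at an end, so only the heights after complete
  blocks have to be checked.\<close>

lemma nonneg_from_block_path: "nonneg_from h (block_path a) \<longleftrightarrow> ballot_from h a"
proof (induction a arbitrary: h)
  case (Cons k a)
  \<comment> \<open>The height \<open>h + k\<close> at the top of the block is nonnegative as soon as \<open>h\<close> is.\<close>
  have "h + int k + rise D = h + (int k - 1)" by simp
  then have "nonneg_from h (block_path (k # a)) \<longleftrightarrow>
      0 \<le> h \<and> 0 \<le> h + int k \<and> ballot_from (h + (int k - 1)) a"
    by (simp only: block_path_simps nonneg_from_replicate_U nonneg_from_simps Cons.IH)
  then show ?case
    unfolding ballot_from_simps by linarith
qed simp

lemma ballot_iff: "a \<in> ballot n \<longleftrightarrow> length a = n \<and> sum_list a = n \<and> ballot_from 0 a"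
  unfolding ballot_def ballot_from_def by force

lemma dyck_iff:
  "w \<in> dyck_paths n \<longleftrightarrow> length w = 2 * n \<and> height w = 0 \<and> nonneg_from 0 w \<and> L \<notin> set w"
  unfolding dyck_paths_def motzkin_paths_def nonneg_from_def by force

lemma block_path_in_dyck_iff: "block_path a \<in> dyck_paths n \<longleftrightarrow> a \<in> ballot n"
proof -
  have "length (block_path a) = 2 * n \<and> height (block_path a) = 0 \<longleftrightarrow> length a = n \<and> sum_list a = n"
    unfolding length_block_path height_block_path by linarith
  then show ?thesis
    unfolding dyck_iff ballot_iff nonneg_from_block_path using L_notin_block_path by blast
qed

lemma replicate_U_D_eq:
  "replicate k U @ D # v = replicate l U @ D # w \<longleftrightarrow> k = l \<and> v = w"
proof (induction k arbitrary: l)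
  case 0
  then show ?case by (cases l) auto
next
  case (Suc k)
  then show ?case by (cases l) auto
qed

lemma inj_block_path: "inj block_path"
proof (rule injI)
  show "block_path a = block_path b \<Longrightarrow> a = b" for a b
  proof (induction a arbitrary: b)
    case Nil
    then show ?case by (cases b) auto
  next
    case (Cons k a)
    then show ?case by (cases b) (auto simp: replicate_U_D_eq)
  qed
qed

lemma ex_block_path: "L \<notin> set w \<Longrightarrow> w = [] \<or> last w = D \<Longrightarrow> \<exists>a. w = block_path a"
proof (induction w)
  case Nil
  have "[] = block_path []" by simp
  then show ?case by blast
next
  case (Cons x w)
  then obtain a where a: "w = block_path a"
    by (auto split: if_splits)
  show ?case
  proof (cases x)
    case D
    then have "x # w = block_path (0 # a)" using a by simp
    then show ?thesis by blast
  next
    case U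
    with Cons.prems a have "a \<noteq> []" by (auto split: if_splits)
    then obtain k b where "a = k # b" by (cases a) auto
    with U a have "x # w = block_path (Suc k # b)" by simp
    then show ?thesis by blast
  next
    case L
    then show ?thesis using Cons.prems by simp
  qed
qed

text \<open>Otherwise the path would be at height \<open>-1\<close> before its last step.\<close>

lemma dyck_last:
  assumes "w \<in> dyck_paths n" "w \<noteq> []"
  shows "last w = D"
proof (rule ccontr)
  assume "last w \<noteq> D"
  moreover have "last w \<in> set w" using assms by simp
  ultimately have "last w = U"
    using assms by (cases "last w") (auto simp: dyck_iff)
  then have w: "w = butlast w @ [U]"
    using assms(2) by (metis append_butlast_last_id)
  have "height w = 0" "0 \<le> height (take (length w - 1) w)"
    using assms by (auto simp: dyck_iff nonneg_from_def)
  moreover have "height w = height (butlast w) + 1"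
    by (subst w) simp
  ultimately show False by (simp add: butlast_conv_take)
qed

lemma bij_betw_block_path: "bij_betw block_path (ballot n) (dyck_paths n)"
  unfolding bij_betw_def
proof
  show "inj_on block_path (ballot n)" using inj_block_path by (rule inj_on_subset) simp
  have "w \<in> block_path ` ballot n" if w: "w \<in> dyck_paths n" for w
  proof -
    have "L \<notin> set w" "w = [] \<or> last w = D"
      using w dyck_last by (auto simp: dyck_iff)
    then obtain a where "w = block_path a" using ex_block_path by blast
    then show ?thesis using w block_path_in_dyck_iff by blast
  qed
  then show "block_path ` ballot n = dyck_paths n"
    using block_path_in_dyck_iff by blast
qed

section \<open>Reversal of Dyck paths\<close>

lemma swap_step_swap_step [simp]: "swap_step (swap_step x) = x"
  by (cases x) auto

lemma rev_path_rev_path [simp]: "rev_path (rev_path w) = w"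
  by (simp add: rev_path_def rev_map comp_def)

lemma height_rev_path: "height (rev_path w) = - height w"
proof (induction w)
  case (Cons x w)
  then show ?case by (cases x) (simp_all add: rev_path_def)
qed (simp add: rev_path_def)

lemma rev_path_in_dyck:
  assumes "w \<in> dyck_paths n"
  shows "rev_path w \<in> dyck_paths n"
proof -
  have "0 \<le> height (take i (rev_path w))" if "i \<le> length w" for i
  proof -
    have "take i (rev_path w) = rev_path (drop (length w - i) w)"
      using that by (simp add: rev_path_def take_map take_rev)
    moreover have "height w = height (take (length w - i) w) + height (drop (length w - i) w)"
      by (metis append_take_drop_id height_simps(3))
    moreover have "0 \<le> height (take (length w - i) w)" "height w = 0"
      using assms by (simp_all add: dyck_iff nonneg_from_def)
    ultimately show ?thesis
      by (simp add: height_rev_path)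
  qed
  moreover have "L \<notin> set (rev_path w)"
  proof
    assume "L \<in> set (rev_path w)"
    then obtain x where "x \<in> set w" "swap_step x = L" by (auto simp: rev_path_def)
    moreover from this have "x = L" by (cases x rule: step.exhaust) auto
    ultimately show False using assms by (simp add: dyck_iff)
  qed
  moreover have "length (rev_path w) = length w" by (simp add: rev_path_def)
  ultimately show ?thesis
    using assms by (auto simp: dyck_iff nonneg_from_def height_rev_path)
qed

lemma bij_betw_rev_path: "bij_betw rev_path (dyck_paths n) (dyck_paths n)"
  by (rule bij_betw_byWitness[where f' = rev_path]) (auto simp: rev_path_in_dyck)

section \<open>Triple ascents\<close>

lemma tu_Nil [simp]: "tu [] = 0"
  by (simp add: tu_def)

text \<open>An occurrence of UUU in \<open>x # w\<close> either starts at the new letter or lies in \<open>w\<close>.\<close>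

lemma tu_Cons: "tu (x # w) = (if x = U \<and> take 2 w = [U, U] then 1 else 0) + tu w"
proof -
  let ?S = "\<lambda>w. {i. i + 2 < length w \<and> w ! i = U \<and> w ! (i + 1) = U \<and> w ! (i + 2) = U}"
  have fin: "finite (?S w)"
    by (rule finite_subset[of _ "{..<length w}"]) auto
  have head: "0 \<in> ?S (x # w) \<longleftrightarrow> x = U \<and> take 2 w = [U, U]"
    by (cases w; cases "tl w") auto
  have "?S (x # w) = (?S (x # w) \<inter> {0}) \<union> Suc ` ?S w"
  proof (intro set_eqI iffI)
    fix i assume "i \<in> ?S (x # w)"
    then show "i \<in> (?S (x # w) \<inter> {0}) \<union> Suc ` ?S w" by (cases i) auto
  qed auto
  moreover have "(?S (x # w) \<inter> {0}) \<inter> Suc ` ?S w = {}" by auto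
  ultimately have "tu (x # w) = card (?S (x # w) \<inter> {0}) + card (Suc ` ?S w)"
    unfolding tu_def using fin by (metis (no_types, lifting) card_Un_disjoint finite_Int finite_imageI finite.intros)
  also have "card (Suc ` ?S w) = tu w" by (simp add: tu_def card_image)
  also have "card (?S (x # w) \<inter> {0}) = (if x = U \<and> take 2 w = [U, U] then 1 else 0)"
    using head by auto
  finally show ?thesis .
qed

lemma tu_D_Cons [simp]: "tu (D # w) = tu w"
  by (simp add: tu_Cons)

lemma tu_replicate_U_D: "tu (replicate k U @ D # w) = (k - 2) + tu w"
proof (induction k)
  case (Suc k)
  have "take 2 (replicate k U @ D # w) = [U, U] \<longleftrightarrow> 2 \<le> k"
    by (cases k; cases "k - 1") auto
  then show ?case using Suc by (auto simp: tu_Cons)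
qed simp

lemma tu_block_path: "tu (block_path a) = (\<Sum>k\<leftarrow>a. k - 2)"
  by (induction a) (simp_all add: tu_replicate_U_D)

definition zero_pairs :: "nat list \<Rightarrow> nat" where
  "zero_pairs a = card {i. Suc i < length a \<and> a ! i = 0 \<and> a ! Suc i = 0}"

lemma zero_pairs_snoc:
  "zero_pairs (a @ [k]) = zero_pairs a + (if a \<noteq> [] \<and> last a = 0 \<and> k = 0 then 1 else 0)"
proof -
  let ?S = "\<lambda>a::nat list. {i. Suc i < length a \<and> a ! i = 0 \<and> a ! Suc i = 0}"
  have fin: "finite (?S a)"
    by (rule finite_subset[of _ "{..<length a}"]) auto
  have "?S (a @ [k]) = ?S a \<union> (if a \<noteq> [] \<and> last a = 0 \<and> k = 0 then {length a - 1} else {})"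
  proof (intro set_eqI)
    fix i
    show "i \<in> ?S (a @ [k]) \<longleftrightarrow>
        i \<in> ?S a \<union> (if a \<noteq> [] \<and> last a = 0 \<and> k = 0 then {length a - 1} else {})"
    proof (cases "Suc i < length a")
      case True
      then have "i \<noteq> length a - 1" by simp
      with True show ?thesis by (simp add: nth_append)
    next
      case False
      show ?thesis
      proof (cases "Suc i = length a")
        case True
        then have "a \<noteq> []" "i = length a - 1" by auto
        then show ?thesis by (simp add: nth_append last_conv_nth)
      next
        case neq: False
        with False have "length a \<le> i" by simp
        then have "i \<noteq> length a - 1" if "a \<noteq> []" using that by (cases a) auto
        with \<open>length a \<le> i\<close> show ?thesis by auto
      qed
    qed
  qed
  moreover have "length a - 1 \<notin> ?S a" by auto
  ultimately show ?thesis using fin by (simp add: zero_pairs_def)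
qed

lemma rev_path_append [simp]: "rev_path (v @ w) = rev_path w @ rev_path v"
  by (simp add: rev_path_def)

lemma tu_replicate_D_append: "tu (replicate k D @ w) = tu w"
  by (induction k) simp_all

text \<open>Reversal turns the block \<open>U\<^sup>k D\<close> into \<open>U D\<^sup>k\<close>, so a run of UUU in the reversed path needs two
  consecutive empty ascents. The third U of the run belongs to the block before those two; it exists
  because the first ascent is not empty.\<close>

lemma tu_rev_path_block_path:
  assumes "a \<noteq> [] \<Longrightarrow> hd a > 0"
  shows "tu (rev_path (block_path a)) = zero_pairs a"
  using assms
proof (induction a rule: rev_induct)
  case Nil
  then show ?case by (simp add: rev_path_def zero_pairs_def)
next
  case (snoc k a)
  have IH: "tu (rev_path (block_path a)) = zero_pairs a"
    using snoc by (cases a) auto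
  have block: "rev_path (block_path (a @ [k])) = U # replicate k D @ rev_path (block_path a)" for a k
    by (simp add: rev_path_def)
  have "take 2 (replicate k D @ rev_path (block_path a)) = [U, U] \<longleftrightarrow>
        a \<noteq> [] \<and> last a = 0 \<and> k = 0"
  proof (cases a rule: rev_cases)
    case Nil
    then show ?thesis by (cases k; cases "k - 1") (auto simp: rev_path_def)
  next
    case a: (snoc b l)
    show ?thesis
    proof (cases "k = 0 \<and> l = 0")
      case True
      \<comment> \<open>The last ascent of \<open>a\<close> is empty and the first is not, so a further block precedes.\<close>
      then have "hd a > 0" "a \<noteq> []" using snoc.prems a by (auto simp: hd_append)
      with True a obtain c m where "b = c @ [m]" by (cases b rule: rev_cases) auto
      with True a show ?thesis by (simp add: rev_path_def)
    next
      case False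
      show ?thesis
      proof (cases k)
        case 0
        with False obtain l' where "l = Suc l'" by (cases l) auto
        with 0 a show ?thesis by (simp only: block) simp
      next
        case (Suc k')
        with a show ?thesis by (simp add: numeral_2_eq_2)
      qed
    qed
  qed
  then show ?case
    using IH by (simp only: block tu_Cons tu_replicate_D_append zero_pairs_snoc) auto
qed

section \<open>Dyck paths without triple ascents and Motzkin paths\<close>

text \<open>The step of rise \<open>k - 1\<close>, which stands for the block \<open>U\<^sup>k D\<close> with \<open>k \<le> 2\<close>; larger arguments
  have no meaning.\<close>

fun small_step :: "nat \<Rightarrow> step" where
  "small_step 0 = D"
| "small_step (Suc 0) = L"
| "small_step _ = U"

fun step_size :: "step \<Rightarrow> nat" where
  "step_size D = 0"
| "step_size L = 1"
| "step_size U = 2"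

lemma rise_eq: "rise x = int (step_size x) - 1"
  by (cases x) auto

text \<open>A step of rise \<open>k - 1\<close> and the block \<open>U\<^sup>k D\<close> change the height by the same amount, so both
  kinds of path obey the same condition on partial sums.\<close>

lemma motzkin_iff:
  "w \<in> motzkin_paths n \<longleftrightarrow> map step_size w \<in> ballot n"
proof -
  have height: "height w = int (sum_list (map step_size w)) - int (length w)"
    by (induction w) (simp_all add: rise_eq)
  have from_iff: "nonneg_from h w \<longleftrightarrow> ballot_from h (map step_size w)" for h
    by (induction w arbitrary: h) (simp_all add: rise_eq)
  have "w \<in> motzkin_paths n \<longleftrightarrow> length w = n \<and> height w = 0 \<and> nonneg_from 0 w"
    unfolding motzkin_paths_def nonneg_from_def by force
  also have "\<dots> \<longleftrightarrow> length w = n \<and> height w = 0 \<and> ballot_from 0 (map step_size w)"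
    unfolding from_iff ..
  also have "\<dots> \<longleftrightarrow> map step_size w \<in> ballot n"
  proof -
    have "height w = 0 \<longleftrightarrow> sum_list (map step_size w) = length w"
      unfolding height by linarith
    then show ?thesis unfolding ballot_iff length_map by metis
  qed
  finally show ?thesis .
qed

lemma card_tu_free_eq_motzkin:
  "card {w \<in> dyck_paths n. tu w = 0} = motzkin_number n"
proof -
  let ?B = "{a \<in> ballot n. \<forall>k\<in>set a. k \<le> 2}"
  have le2: "step_size x \<le> 2" for x
    by (cases x) auto
  have small: "step_size (small_step k) = k" if "k \<le> 2" for k
    using that by (cases k rule: small_step.cases) auto
  have "small_step (step_size x) = x" for x
    by (cases x) (auto simp: numeral_2_eq_2)
  then have left_inv: "map small_step (map step_size w) = w" for w
    by (simp add: map_idI)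
  have right_inv: "map step_size (map small_step a) = a" if "a \<in> ?B" for a
    using that small by (simp add: map_idI)
  have "bij_betw (map step_size) (motzkin_paths n) ?B"
  proof (rule bij_betw_byWitness[where f' = "map small_step"])
    show "map step_size ` motzkin_paths n \<subseteq> ?B"
      using le2 motzkin_iff by auto
    show "map small_step ` ?B \<subseteq> motzkin_paths n"
      unfolding image_subset_iff motzkin_iff using right_inv by simp
  qed (use left_inv right_inv in blast)+
  then have "motzkin_number n = card ?B"
    unfolding motzkin_number_def by (rule bij_betw_same_card)
  also have "\<dots> = card (block_path ` ?B)"
    by (rule card_image[OF inj_on_subset[OF inj_block_path], symmetric]) simp
  also have "block_path ` ?B = {w \<in> dyck_paths n. tu w = 0}"
    unfolding bij_betw_imp_surj_on[OF bij_betw_block_path, of n, symmetric] by (auto simp: tu_block_path)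
  finally show ?thesis by simp
qed

section \<open>Running maxima of permutations\<close>

primrec running_max :: "(nat \<Rightarrow> nat) \<Rightarrow> nat \<Rightarrow> nat" where
  "running_max f 0 = 0"
| "running_max f (Suc j) = max (running_max f j) (f (Suc j))"

lemma le_running_max: "i \<in> {1..j} \<Longrightarrow> f i \<le> running_max f j"
  by (induction j) (auto simp: le_Suc_eq)

lemma running_max_attained:
  "running_max f j = 0 \<or> (\<exists>i\<in>{1..j}. running_max f j = f i)"
proof (induction j)
  case (Suc j)
  have "running_max f (Suc j) = running_max f j \<or> running_max f (Suc j) = f (Suc j)"
    by (simp add: max_def)
  then show ?case
  proof
    assume "running_max f (Suc j) = running_max f j"
    with Suc show ?thesis by (metis atLeastAtMost_iff le_SucI)
  next
    assume "running_max f (Suc j) = f (Suc j)"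
    moreover have "Suc j \<in> {1..Suc j}" by simp
    ultimately show ?thesis by blast
  qed
qed simp

lemma running_max_eqI:
  assumes "i \<in> {1..j}" "f i = v" "\<And>k. k \<in> {1..j} \<Longrightarrow> f k \<le> v"
  shows "running_max f j = v"
proof (rule antisym)
  show "running_max f j \<le> v"
    using running_max_attained[of f j] assms(3) by auto
  show "v \<le> running_max f j"
    using le_running_max[OF assms(1), of f] assms(2) by simp
qed

definition jumps :: "nat \<Rightarrow> (nat \<Rightarrow> nat) \<Rightarrow> nat list" where
  "jumps n f = map (\<lambda>j. running_max f (Suc j) - running_max f j) [0..<n]"

lemma length_jumps [simp]: "length (jumps n f) = n"
  by (simp add: jumps_def)

lemma nth_jumps: "j < n \<Longrightarrow> jumps n f ! j = running_max f (Suc j) - running_max f j"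
  by (simp add: jumps_def)

lemma sum_take_jumps: "j \<le> n \<Longrightarrow> sum_list (take j (jumps n f)) = running_max f j"
proof (induction j)
  case (Suc j)
  then show ?case
    by (simp add: take_Suc_conv_app_nth nth_jumps)
qed simp

lemma jumps_eq_iff:
  "jumps n f = jumps n g \<longleftrightarrow> (\<forall>j\<le>n. running_max f j = running_max g j)"
proof
  show "\<forall>j\<le>n. running_max f j = running_max g j" if "jumps n f = jumps n g"
    using that sum_take_jumps[of _ n f] sum_take_jumps[of _ n g] by simp
  show "jumps n f = jumps n g" if "\<forall>j\<le>n. running_max f j = running_max g j"
    using that by (auto simp: jumps_def simp del: running_max.simps)
qed

lemma perms_D:
  assumes "\<sigma> \<in> perms n"
  shows "\<sigma> permutes {1..n}" "inj \<sigma>" "i \<in> {1..n} \<Longrightarrow> \<sigma> i \<in> {1..n}"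
  using assms by (auto simp: perms_def permutes_inj dest: permutes_in_image)

text \<open>The first \<open>j\<close> entries are \<open>j\<close> distinct positive numbers.\<close>

lemma le_running_max_perm:
  assumes "\<sigma> \<in> perms n" "j \<le> n"
  shows "j \<le> running_max \<sigma> j"
proof -
  have "\<sigma> ` {1..j} \<subseteq> {1..running_max \<sigma> j}"
  proof
    fix v assume "v \<in> \<sigma> ` {1..j}"
    then obtain i where i: "i \<in> {1..j}" "v = \<sigma> i" by blast
    then have "\<sigma> i \<in> {1..n}" using assms perms_D(3)[of \<sigma> n i] by simp
    with i show "v \<in> {1..running_max \<sigma> j}" using le_running_max[of i j \<sigma>] by simp
  qed
  then have "card (\<sigma> ` {1..j}) \<le> card {1..running_max \<sigma> j}"
    by (rule card_mono[rotated]) simp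
  moreover have "card (\<sigma> ` {1..j}) = j"
    using perms_D(2)[OF assms(1)] by (simp add: card_image inj_on_subset)
  ultimately show ?thesis by simp
qed

lemma running_max_perm_le:
  assumes "\<sigma> \<in> perms n" "j \<le> n"
  shows "running_max \<sigma> j \<le> n"
  using running_max_attained[of \<sigma> j]
proof
  assume "\<exists>i\<in>{1..j}. running_max \<sigma> j = \<sigma> i"
  then obtain i where "i \<in> {1..j}" "running_max \<sigma> j = \<sigma> i" by blast
  then show ?thesis using perms_D(3)[OF assms(1), of i] assms(2) by simp
qed simp

lemma jumps_in_ballot:
  assumes "\<sigma> \<in> perms n"
  shows "jumps n \<sigma> \<in> ballot n"
proof -
  have "sum_list (jumps n \<sigma>) = running_max \<sigma> n"
    using sum_take_jumps[of n n \<sigma>] by simp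
  also have "\<dots> = n"
    using le_running_max_perm[OF assms] running_max_perm_le[OF assms] by (simp add: antisym)
  finally show ?thesis
    using le_running_max_perm[OF assms] by (simp add: ballot_def sum_take_jumps)
qed

lemma perm_ne_running_max:
  assumes "\<sigma> \<in> perms n" "Suc j \<le> n"
  shows "\<sigma> (Suc j) \<noteq> running_max \<sigma> j"
proof
  assume eq: "\<sigma> (Suc j) = running_max \<sigma> j"
  have "\<sigma> (Suc j) \<noteq> 0"
    using perms_D(3)[OF assms(1), of "Suc j"] assms(2) by simp
  with eq running_max_attained[of \<sigma> j] obtain i where "i \<in> {1..j}" "\<sigma> (Suc j) = \<sigma> i"
    by metis
  then show False using injD[OF perms_D(2)[OF assms(1)], of "Suc j" i] by simp
qed

text \<open>Position \<open>Suc j\<close> is called a record if it holds a left-to-right maximum. The strict inequality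
  on the right is the form in which non-records are recognised below.\<close>

lemma jumps_eq_0_iff:
  assumes "\<sigma> \<in> perms n" "j < n"
  shows "jumps n \<sigma> ! j = 0 \<longleftrightarrow> \<sigma> (Suc j) < running_max \<sigma> (Suc j)"
proof -
  have "\<sigma> (Suc j) \<noteq> running_max \<sigma> j"
    using perm_ne_running_max assms by (simp add: Suc_le_eq)
  moreover have "jumps n \<sigma> ! j = max (running_max \<sigma> j) (\<sigma> (Suc j)) - running_max \<sigma> j"
    using assms(2) by (simp add: nth_jumps)
  ultimately show ?thesis by simp linarith
qed

section \<open>Permutations avoiding 321 and their records\<close>

lemma mem_perms_avoiding_321_iff:
  "\<sigma> \<in> perms_avoiding_321 n \<longleftrightarrow> \<sigma> \<in> perms n \<and>
     (\<forall>i j k. 1 \<le> i \<longrightarrow> i < j \<longrightarrow> j < k \<longrightarrow> k \<le> n \<longrightarrow> \<not> (\<sigma> k < \<sigma> j \<and> \<sigma> j < \<sigma> i))"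
proof -
  have less3: "(\<forall>p<3. Q p) \<longleftrightarrow> Q 0 \<and> Q 1 \<and> Q (2::nat)" for Q
    by (auto simp: numeral_3_eq_3 numeral_2_eq_2 less_Suc_eq)
  have length3: "length [3, 2, 1::nat] = 3" by simp
  have "contains_pattern n \<sigma> [3, 2, 1] \<longleftrightarrow>
    (\<exists>i j k. 1 \<le> i \<and> i < j \<and> j < k \<and> k \<le> n \<and> \<sigma> k < \<sigma> j \<and> \<sigma> j < \<sigma> i)"
  proof
    assume "contains_pattern n \<sigma> [3, 2, 1]"
    then obtain "is" where "length is = 3" and is_props: "sorted_wrt (<) is" "set is \<subseteq> {1..n}"
      "\<forall>p<3. \<forall>q<3. \<sigma> (is ! p) < \<sigma> (is ! q) \<longleftrightarrow> [3, 2, 1::nat] ! p < [3, 2, 1] ! q"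
      unfolding contains_pattern_def length3 by blast
    then obtain i j k where "is = [i, j, k]"
      by (auto simp: numeral_3_eq_3 length_Suc_conv)
    with is_props show "\<exists>i j k. 1 \<le> i \<and> i < j \<and> j < k \<and> k \<le> n \<and> \<sigma> k < \<sigma> j \<and> \<sigma> j < \<sigma> i"
      by (intro exI[of _ i] exI[of _ j] exI[of _ k]) (auto simp: less3)
  next
    assume "\<exists>i j k. 1 \<le> i \<and> i < j \<and> j < k \<and> k \<le> n \<and> \<sigma> k < \<sigma> j \<and> \<sigma> j < \<sigma> i"
    then obtain i j k where "1 \<le> i" "i < j" "j < k" "k \<le> n" "\<sigma> k < \<sigma> j" "\<sigma> j < \<sigma> i"
      by blast
    then show "contains_pattern n \<sigma> [3, 2, 1]"
      unfolding contains_pattern_def length3 less3 by (intro exI[of _ "[i, j, k]"]) simp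
  qed
  then show ?thesis
    unfolding perms_avoiding_321_def by auto
qed

text \<open>A non-record has a larger entry to its left, so a smaller entry to its right would complete
  the pattern 321.\<close>

lemma nonrecords_increasing:
  assumes \<sigma>: "\<sigma> \<in> perms_avoiding_321 n" and "i \<in> {1..n}" "j \<in> {1..n}" "i < j"
    and "\<sigma> i < running_max \<sigma> i"
  shows "\<sigma> i < \<sigma> j"
proof -
  have perm: "\<sigma> \<in> perms n" using \<sigma> by (simp add: mem_perms_avoiding_321_iff)
  obtain l where l: "l \<in> {1..i}" "running_max \<sigma> i = \<sigma> l"
    using running_max_attained[of \<sigma> i] assms(5) by auto
  with assms(5) have "l < i" by (cases "l = i") auto
  with l assms have "\<not> (\<sigma> j < \<sigma> i \<and> \<sigma> i < \<sigma> l)"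
    by (auto simp: mem_perms_avoiding_321_iff)
  moreover have "\<sigma> i \<noteq> \<sigma> j"
    using injD[OF perms_D(2)[OF perm], of i j] assms(4) by auto
  ultimately show ?thesis using l assms(5) by simp
qed

text \<open>Both functions list the elements of the common image in increasing order.\<close>

lemma strict_mono_on_eqI:
  fixes f g :: "'a :: linorder \<Rightarrow> 'b :: linorder"
  assumes "finite A" "strict_mono_on A f" "strict_mono_on A g" "f ` A = g ` A" "x \<in> A"
  shows "f x = g x"
proof -
  have sorted: "sorted_wrt (<) (map h (sorted_list_of_set A))"
    if h: "strict_mono_on A h" for h :: "'a \<Rightarrow> 'b"
    unfolding sorted_wrt_map
    by (rule sorted_wrt_mono_rel[OF _ strict_sorted_list_of_set])
       (use assms(1) strict_mono_onD[OF h] in auto)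
  have "map f (sorted_list_of_set A) = map g (sorted_list_of_set A)"
    using assms by (intro strict_sorted_equal sorted) auto
  then show ?thesis using assms(1,5) by simp
qed

text \<open>The jumps determine the set \<open>N\<close> of non-records and the values at the records. The remaining
  values are taken on \<open>N\<close> in increasing order, which leaves no choice.\<close>

lemma inj_on_jumps: "inj_on (jumps n) (perms_avoiding_321 n)"
proof (rule inj_onI, rule ext)
  fix \<sigma> \<tau> x
  assume \<sigma>: "\<sigma> \<in> perms_avoiding_321 n" and \<tau>: "\<tau> \<in> perms_avoiding_321 n"
    and "jumps n \<sigma> = jumps n \<tau>"
  then have M: "running_max \<sigma> j = running_max \<tau> j" if "j \<le> n" for j
    using that by (simp add: jumps_eq_iff)
  have perms: "\<sigma> \<in> perms n" "\<tau> \<in> perms n"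
    using \<sigma> \<tau> by (simp_all add: mem_perms_avoiding_321_iff)
  have nonrec: "\<rho> j < running_max \<rho> j \<longleftrightarrow> jumps n \<rho> ! (j - 1) = 0"
    if "\<rho> \<in> perms n" "j \<in> {1..n}" for \<rho> j
    using jumps_eq_0_iff[OF that(1), of "j - 1"] that(2)
    by (cases j) (simp_all del: running_max.simps)
  define N where "N = {j \<in> {1..n}. jumps n \<sigma> ! (j - 1) = 0}"
  have N: "j \<in> N \<longleftrightarrow> j \<in> {1..n} \<and> \<rho> j < running_max \<rho> j" if "\<rho> \<in> {\<sigma>, \<tau>}" for \<rho> j
    using nonrec[of \<rho> j] that perms \<open>jumps n \<sigma> = jumps n \<tau>\<close> by (auto simp: N_def)
  have at_record: "\<rho> j = running_max \<sigma> j" if "j \<in> {1..n} - N" "\<rho> \<in> {\<sigma>, \<tau>}" for \<rho> j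
    using that N[OF that(2), of j] M[of j] le_running_max[of j j \<rho>] by auto
  have image: "\<rho> ` N = {1..n} - running_max \<sigma> ` ({1..n} - N)" if "\<rho> \<in> {\<sigma>, \<tau>}" for \<rho>
  proof -
    have "\<rho> permutes {1..n}" using that perms by (auto simp: perms_def)
    have "N \<subseteq> {1..n}" by (auto simp: N_def)
    then have "\<rho> ` N = \<rho> ` {1..n} - \<rho> ` ({1..n} - N)"
      using permutes_inj[OF \<open>\<rho> permutes {1..n}\<close>]
      by (metis Diff_Diff_Int image_set_diff inf.absorb_iff2)
    also have "\<rho> ` {1..n} = {1..n}" using \<open>\<rho> permutes {1..n}\<close> by (rule permutes_image)
    also have "\<rho> ` ({1..n} - N) = running_max \<sigma> ` ({1..n} - N)"
      using at_record[OF _ that] by (intro image_cong) auto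
    finally show ?thesis .
  qed
  have mono: "strict_mono_on N \<rho>" if "\<rho> \<in> {\<sigma>, \<tau>}" for \<rho>
  proof (rule strict_mono_onI)
    fix i j assume "i \<in> N" "j \<in> N" "i < j"
    then show "\<rho> i < \<rho> j"
      using nonrecords_increasing[of \<rho> n i j] N[OF that] that \<sigma> \<tau> by blast
  qed
  have "finite N" by (simp add: N_def)
  consider "x \<in> N" | "x \<in> {1..n} - N" | "x \<notin> {1..n}" by blast
  then show "\<sigma> x = \<tau> x"
  proof cases
    case 1
    then show ?thesis
      using strict_mono_on_eqI[OF \<open>finite N\<close> mono[of \<sigma>] mono[of \<tau>]] image[of \<sigma>] image[of \<tau>] by simp
  next
    case 2
    then show ?thesis using at_record[of x \<sigma>] at_record[of x \<tau>] by simp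
  next
    case 3
    then show ?thesis using perms by (simp add: perms_def permutes_def)
  qed
qed

lemma ex_strict_mono_bij:
  fixes A :: "'a :: wellorder set" and B :: "'b :: wellorder set"
  assumes "finite A" "finite B" "card A = card B"
  shows "\<exists>h. bij_betw h A B \<and> strict_mono_on A h"
proof -
  obtain e where e: "bij_betw e {..<card A} A" "strict_mono_on {..<card A} e"
    using ex_bij_betw_strict_mono_card[OF assms(1)] .
  obtain f where f: "bij_betw f {..<card A} B" "strict_mono_on {..<card A} f"
    using ex_bij_betw_strict_mono_card[OF assms(2)] assms(3) by metis
  let ?e' = "inv_into {..<card A} e"
  have e': "bij_betw ?e' A {..<card A}"
    using e(1) by (rule bij_betw_inv_into)
  have "?e' x < ?e' y" if "x \<in> A" "y \<in> A" "x < y" for x y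
  proof (rule ccontr)
    assume "\<not> ?e' x < ?e' y"
    then have "e (?e' y) \<le> e (?e' x)"
      using e' that by (intro strict_mono_on_leD[OF e(2)]) (auto simp: bij_betw_def)
    then show False using that e(1) by (simp add: bij_betw_inv_into_right)
  qed
  then have "strict_mono_on A (f \<circ> ?e')"
    using e' by (intro strict_mono_onI) (auto simp: bij_betw_def intro!: strict_mono_onD[OF f(2)])
  with bij_betw_trans[OF e' f(1)] show ?thesis by blast
qed

text \<open>With \<open>s\<close> the partial sums of \<open>a\<close>, the records have to be the positions \<open>P\<close> where \<open>s\<close>
  increases, with the values \<open>s\<close>; the other positions \<open>N\<close> receive the other values \<open>W\<close> in increasing
  order. The point to check is that no filler exceeds the running maximum (\<open>h_le\<close> in the proof): among
  the values up to \<open>s j\<close>, exactly one for each record up to \<open>j\<close> is used by a record, so at least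
  \<open>j - card (P \<inter> {1..j}) = card (N \<inter> {1..j})\<close> of them are left for fillers.\<close>

lemma ex_perm_with_jumps:
  assumes a: "a \<in> ballot n"
  shows "\<exists>\<sigma>\<in>perms_avoiding_321 n. jumps n \<sigma> = a"
proof -
  define s where "s j = sum_list (take j a)" for j
  have s0: "s 0 = 0" and sn: "s n = n" and len: "length a = n" and le_s: "\<And>j. j \<le> n \<Longrightarrow> j \<le> s j"
    using a by (auto simp: ballot_def s_def)
  have s_Suc: "s (Suc j) = s j + a ! j" if "j < n" for j
    using that len by (simp add: s_def take_Suc_conv_app_nth)
  have s_mono: "s i \<le> s j" if "i \<le> j" "j \<le> n" for i j
    using that(1,2) by (induction rule: dec_induct) (auto simp: s_Suc)
  define P where "P = {j \<in> {1..n}. s (j - 1) < s j}"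
  define N where "N = {1..n} - P"
  define W where "W = {1..n} - s ` P"
  have PN: "P \<union> N = {1..n}" "P \<inter> N = {}" and fin: "finite P" "finite N" "finite W"
    by (auto simp: P_def N_def W_def)
  have s_strict: "s i < s j" if "j \<in> P" "i < j" for i j
  proof -
    have "s i \<le> s (j - 1)" using that by (intro s_mono) (auto simp: P_def)
    then show ?thesis using that by (simp add: P_def)
  qed
  then have s_mono_P: "strict_mono_on P s" by (intro strict_mono_onI)
  have sP: "s ` P \<subseteq> {1..n}"
  proof
    fix v assume "v \<in> s ` P"
    then obtain j where "j \<in> {1..n}" "v = s j" by (auto simp: P_def)
    then show "v \<in> {1..n}" using le_s[of j] s_mono[of j n] sn by auto
  qed
  have card_sP: "card (s ` P) = card P"
    using s_mono_P by (intro card_image strict_mono_on_imp_inj_on)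
  have "card N = n - card P"
    unfolding N_def by (subst card_Diff_subset) (auto simp: P_def)
  also have "\<dots> = card W"
    unfolding W_def using sP fin card_sP by (subst card_Diff_subset) auto
  finally obtain h where h: "bij_betw h N W" "strict_mono_on N h"
    using ex_strict_mono_bij[OF fin(2,3)] by blast
  have h_le: "h j \<le> s j" if j: "j \<in> N" for j
  proof (rule ccontr)
    assume "\<not> h j \<le> s j"
    have jn: "j \<in> {1..n}" using j by (simp add: N_def)
    then have sj: "s j \<le> n" using s_mono[of j n] sn by simp
    \<comment> \<open>If the filler at \<open>j\<close> were larger than \<open>s j\<close>, all values of \<open>W\<close> up to \<open>s j\<close> would be placed
      strictly before \<open>j\<close>, where there is too little room.\<close>
    have "W \<inter> {1..s j} \<subseteq> h ` (N \<inter> {1..<j})"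
    proof
      fix v assume v: "v \<in> W \<inter> {1..s j}"
      then obtain i where i: "i \<in> N" "v = h i" using h(1) by (auto simp: bij_betw_def)
      have "i < j"
      proof (rule ccontr)
        assume "\<not> i < j"
        then have "h j \<le> h i" using i j strict_mono_on_leD[OF h(2)] by simp
        then show False using v i \<open>\<not> h j \<le> s j\<close> by simp
      qed
      with i show "v \<in> h ` (N \<inter> {1..<j})" by (auto simp: N_def)
    qed
    then have "card (W \<inter> {1..s j}) \<le> card (N \<inter> {1..<j})"
      by (rule surj_card_le[rotated]) (simp add: fin)
    also have "N \<inter> {1..<j} = (N \<inter> {1..j}) - {j}"
      by (intro set_eqI) (simp, linarith)
    also have "card \<dots> < card (N \<inter> {1..j})"
      using j jn fin by (intro card_Diff1_less) simp_all
    also have "N \<inter> {1..j} = {1..j} - (P \<inter> {1..j})"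
      using jn by (auto simp: N_def)
    also have "card \<dots> = j - card (P \<inter> {1..j})"
      by (subst card_Diff_subset) auto
    also have "\<dots> \<le> s j - card (P \<inter> {1..j})"
      using le_s[of j] jn by simp
    also have "card (P \<inter> {1..j}) = card (s ` (P \<inter> {1..j}))"
      by (rule card_image[OF inj_on_subset[OF strict_mono_on_imp_inj_on[OF s_mono_P]], symmetric])
         simp
    also have "s ` (P \<inter> {1..j}) = s ` P \<inter> {1..s j}"
    proof (intro equalityI subsetI)
      fix v assume "v \<in> s ` (P \<inter> {1..j})"
      then show "v \<in> s ` P \<inter> {1..s j}" using sP s_mono jn by auto
    next
      fix v assume "v \<in> s ` P \<inter> {1..s j}"
      then obtain i where i: "i \<in> P" "v = s i" "s i \<le> s j" by auto
      then have "i \<le> j" using s_strict[of i j] by (meson not_le)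
      with i show "v \<in> s ` (P \<inter> {1..j})" by (auto simp: P_def)
    qed
    also have "s j - card (s ` P \<inter> {1..s j}) = card ({1..s j} - (s ` P \<inter> {1..s j}))"
      by (subst card_Diff_subset) auto
    also have "{1..s j} - (s ` P \<inter> {1..s j}) = W \<inter> {1..s j}"
      using sj by (auto simp: W_def)
    finally show False by simp
  qed
  define \<sigma> where "\<sigma> j = (if j \<in> P then s j else if j \<in> N then h j else j)" for j
  have "bij_betw \<sigma> P (s ` P)"
    using strict_mono_on_imp_inj_on[OF s_mono_P]
    by (auto simp: bij_betw_def \<sigma>_def inj_on_def)
  moreover have "bij_betw \<sigma> N W"
    using h(1) by (rule bij_betw_cong[THEN iffD2, rotated]) (use PN in \<open>auto simp: \<sigma>_def\<close>)
  moreover have "s ` P \<union> W = {1..n}" "s ` P \<inter> W = {}" using sP by (auto simp: W_def)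
  ultimately have "bij_betw \<sigma> {1..n} {1..n}"
    using bij_betw_combine[of \<sigma> P "s ` P" N W] PN by simp
  then have "\<sigma> permutes {1..n}"
    by (rule bij_imp_permutes) (use PN in \<open>auto simp: \<sigma>_def\<close>)
  then have perm: "\<sigma> \<in> perms n" by (simp add: perms_def)
  have M: "running_max \<sigma> j = s j" if "j \<le> n" for j
    using that
  proof (induction j)
    case (Suc j)
    show ?case
    proof (cases "Suc j \<in> P")
      case True
      then show ?thesis using Suc s_strict[of "Suc j" j] by (simp add: \<sigma>_def)
    next
      case False
      then have N: "Suc j \<in> N" and "s (Suc j) = s j"
        using Suc.prems s_mono[of j "Suc j"] by (auto simp: N_def P_def)
      then show ?thesis using Suc False h_le[OF N] by (simp add: \<sigma>_def)
    qed
  qed (simp add: s0)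
  have "jumps n \<sigma> = a"
    by (rule nth_equalityI) (simp_all add: len nth_jumps M s_Suc del: running_max.simps)
  moreover have "\<sigma> \<in> perms_avoiding_321 n"
    unfolding mem_perms_avoiding_321_iff
  proof (intro conjI allI impI notI perm)
    fix i j k assume ijk: "1 \<le> i" "i < j" "j < k" "k \<le> n" "\<sigma> k < \<sigma> j \<and> \<sigma> j < \<sigma> i"
    have incP: "\<sigma> x < \<sigma> y" if "x \<in> P" "y \<in> P" "x < y" for x y
      using that s_strict by (simp add: \<sigma>_def)
    have incN: "\<sigma> x < \<sigma> y" if "x \<in> N" "y \<in> N" "x < y" for x y
      using that strict_mono_onD[OF h(2)] PN by (auto simp: \<sigma>_def)
    \<comment> \<open>The entries increase along \<open>P\<close> and along \<open>N\<close>, and two of the three positions lie in the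
      same class.\<close>
    have same_class: "\<not> (x \<in> P \<and> y \<in> P)" "\<not> (x \<in> N \<and> y \<in> N)"
      if "x < y" "\<sigma> y < \<sigma> x" for x y
      using incP[of x y] incN[of x y] that by auto
    have "i \<in> P \<union> N" "j \<in> P \<union> N" "k \<in> P \<union> N" using ijk PN by auto
    moreover have "i < k" "\<sigma> k < \<sigma> i" using ijk by auto
    ultimately show False
      using same_class[of i j] same_class[of j k] same_class[of i k] ijk(2,3,5) by blast
  qed
  ultimately show ?thesis by blast
qed

lemma bij_betw_jumps: "bij_betw (jumps n) (perms_avoiding_321 n) (ballot n)"
  unfolding bij_betw_def
proof
  show "jumps n ` perms_avoiding_321 n = ballot n"
  proof (intro equalityI subsetI)
    fix a assume "a \<in> jumps n ` perms_avoiding_321 n"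
    then obtain \<sigma> where "\<sigma> \<in> perms_avoiding_321 n" "a = jumps n \<sigma>" by blast
    then show "a \<in> ballot n" using jumps_in_ballot mem_perms_avoiding_321_iff by blast
  next
    fix a assume "a \<in> ballot n"
    then show "a \<in> jumps n ` perms_avoiding_321 n" using ex_perm_with_jumps by blast
  qed
qed (rule inj_on_jumps)

section \<open>Krattenthaler's word in terms of the jumps\<close>

lemma record_iff:
  assumes "\<sigma> \<in> perms n" "Suc j \<le> n"
  shows "(\<forall>i\<in>{1..<Suc j}. \<sigma> i < \<sigma> (Suc j)) \<longleftrightarrow> running_max \<sigma> j < \<sigma> (Suc j)"
proof
  assume records: "\<forall>i\<in>{1..<Suc j}. \<sigma> i < \<sigma> (Suc j)"
  have "0 < \<sigma> (Suc j)" using perms_D(3)[OF assms(1), of "Suc j"] assms(2) by simp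
  from running_max_attained[of \<sigma> j] show "running_max \<sigma> j < \<sigma> (Suc j)"
  proof
    assume "\<exists>i\<in>{1..j}. running_max \<sigma> j = \<sigma> i"
    then obtain i where "i \<in> {1..j}" "running_max \<sigma> j = \<sigma> i" by blast
    with records show ?thesis by simp
  qed (use \<open>0 < \<sigma> (Suc j)\<close> in simp)
next
  assume "running_max \<sigma> j < \<sigma> (Suc j)"
  moreover have "\<sigma> i \<le> running_max \<sigma> j" if "i \<in> {1..<Suc j}" for i
    using that by (intro le_running_max) simp
  ultimately show "\<forall>i\<in>{1..<Suc j}. \<sigma> i < \<sigma> (Suc j)"
    by (blast intro: order_le_less_trans)
qed

text \<open>The positions from one record up to the next one contribute a positive jump followed by zeros,
  and \<open>U\<^sup>r D\<close> followed by \<open>m\<close> blocks \<open>U\<^sup>0 D\<close> is the factor \<open>U\<^sup>r D\<^bsup>m+1\<^esup>\<close> that the map assigns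
  to this stretch.\<close>

lemma Psi_K_eq_block_path_jumps:
  assumes \<sigma>: "\<sigma> \<in> perms n"
  shows "Psi_K n \<sigma> = block_path (jumps n \<sigma>)"
proof -
  let ?M = "running_max \<sigma>"
  define ps where "ps = lr_max_positions n \<sigma>"
  define next_pos where "next_pos k = (if k < length ps then ps ! k else n + 1)" for k
  have sorted: "sorted_wrt (<) ps"
    unfolding ps_def lr_max_positions_def by (intro sorted_wrt_filter sorted_wrt_upt)
  have set_ps_eq: "set ps = {i \<in> {1..n}. \<forall>j\<in>{1..<i}. \<sigma> j < \<sigma> i}"
    unfolding ps_def lr_max_positions_def
    by (simp only: set_filter set_upt Suc_eq_plus1[symmetric] atLeastLessThanSuc_atLeastAtMost)
  have set_ps: "Suc j \<in> set ps \<longleftrightarrow> ?M j < \<sigma> (Suc j)" if "Suc j \<le> n" for j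
  proof -
    have "Suc j \<in> set ps \<longleftrightarrow> (\<forall>i\<in>{1..<Suc j}. \<sigma> i < \<sigma> (Suc j))"
      using that by (simp add: set_ps_eq)
    then show ?thesis unfolding record_iff[OF \<sigma> that] .
  qed
  have ps_range: "p \<in> {1..n}" if "p \<in> set ps" for p
    using that set_ps_eq by blast
  have next_bounds: "1 \<le> next_pos k" "next_pos k \<le> n + 1" for k
    using ps_range[OF nth_mem, of k] by (auto simp: next_pos_def)
  have less_next: "ps ! k < next_pos (Suc k)" if "k < length ps" for k
    using that sorted_wrt_nth_less[OF sorted, of k "Suc k"] ps_range[OF nth_mem, of k]
    by (auto simp: next_pos_def)
  have gap: "x \<notin> set ps" if "k < length ps" "ps ! k < x" "x < next_pos (Suc k)" for k x
  proof
    assume "x \<in> set ps"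
    then obtain m where m: "m < length ps" "x = ps ! m" by (auto simp: in_set_conv_nth)
    have "k < m"
      using that m sorted_wrt_nth_less[OF sorted, of m k] by (cases m k rule: linorder_cases) auto
    then have "next_pos (Suc k) \<le> ps ! m"
      using m sorted_wrt_nth_less[OF sorted, of "Suc k" m]
      by (cases "Suc k = m") (auto simp: next_pos_def)
    then show False using that m by simp
  qed
  \<comment> \<open>The running maximum stays at a record value until the next record.\<close>
  have max_const: "?M j = \<sigma> (ps ! k)"
    if k: "k < length ps" and "ps ! k \<le> j" "j < next_pos (Suc k)" for k j
    using that(2,3)
  proof (induction rule: dec_induct)
    case base
    obtain i where i: "ps ! k = Suc i" "Suc i \<le> n"
      using ps_range[OF nth_mem[OF k]] by (cases "ps ! k") auto
    then have "?M i < \<sigma> (Suc i)" using set_ps[OF i(2)] nth_mem[OF k] by simp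
    then show ?case using i by simp
  next
    case (step j)
    have "Suc j \<notin> set ps" using gap[OF k, of "Suc j"] step by simp
    moreover have "Suc j \<le> n" using step.prems next_bounds(2)[of "Suc k"] by simp
    ultimately have "\<sigma> (Suc j) \<le> ?M j" using set_ps[of j] by simp
    then show ?case using step by simp
  qed
  have max_prev: "?M (next_pos k - 1) = lr_max n \<sigma> k" if "k \<le> length ps" for k
  proof (cases k)
    case 0
    have "next_pos 0 = 1"
    proof (cases "n = 0")
      case True
      then show ?thesis using next_bounds[of 0] by simp
    next
      case False
      then have "1 \<in> set ps" by (auto simp: ps_def lr_max_positions_def)
      then obtain m where "m < length ps" "ps ! m = 1" by (auto simp: in_set_conv_nth)
      then show ?thesis
        using sorted_wrt_nth_less[OF sorted, of 0 m] ps_range[OF nth_mem, of 0]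
        by (cases "m = 0") (auto simp: next_pos_def)
    qed
    then show ?thesis using 0 by (simp add: lr_max_def)
  next
    case (Suc i)
    then have "?M (next_pos k - 1) = \<sigma> (ps ! i)"
      using that less_next[of i] by (intro max_const) auto
    then show ?thesis using Suc by (simp add: lr_max_def ps_def)
  qed
  let ?F = "\<lambda>i. replicate (lr_max n \<sigma> i - lr_max n \<sigma> (i - 1)) U @
                 replicate (length (lr_subword n \<sigma> i) + 1) D"
  have block_path_zeros: "block_path (replicate m 0) = replicate m D" for m
    by (induction m) simp_all
  \<comment> \<open>The first \<open>k\<close> factors exhaust the positions before the record number \<open>k + 1\<close>.\<close>
  have "concat (map ?F [1..<k + 1]) = block_path (take (next_pos k - 1) (jumps n \<sigma>))"
    if "k \<le> length ps" for k
    using that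
  proof (induction k)
    case 0
    then show ?case using max_prev[of 0] next_bounds
    proof -
      have "next_pos 0 - 1 \<le> n" using next_bounds(2)[of 0] by simp
      then have "next_pos 0 - 1 \<le> ?M (next_pos 0 - 1)"
        by (rule le_running_max_perm[OF \<sigma>])
      then show ?thesis using max_prev[of 0] by (simp add: lr_max_def)
    qed
  next
    case (Suc k)
    then have k: "k < length ps" by simp
    let ?p = "ps ! k" and ?q = "next_pos (Suc k)"
    have p: "next_pos k = ?p" using k by (simp add: next_pos_def)
    have pq: "?p < ?q" and q: "?q \<le> n + 1" and p1: "1 \<le> ?p"
      using less_next[OF k] next_bounds(2)[of "Suc k"] next_bounds(1)[of k] p by auto
    let ?r = "lr_max n \<sigma> (Suc k) - lr_max n \<sigma> k"
    have Mp: "?M ?p = lr_max n \<sigma> (Suc k)"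
      using max_const[OF k order_refl pq] by (simp add: lr_max_def ps_def)
    have "take (?q - 1) (jumps n \<sigma>)
        = take (?p - 1) (jumps n \<sigma>) @ ?r # replicate (?q - ?p - 1) 0"
    proof (rule nth_equalityI)
      fix i assume "i < length (take (?q - 1) (jumps n \<sigma>))"
      then have i: "i < ?q - 1" "i < n" by auto
      consider "i < ?p - 1" | "i = ?p - 1" | "?p \<le> i" by linarith
      then show "take (?q - 1) (jumps n \<sigma>) ! i
        = (take (?p - 1) (jumps n \<sigma>) @ ?r # replicate (?q - ?p - 1) 0) ! i"
      proof cases
        case 1
        then show ?thesis using i by (simp add: nth_append)
      next
        case 2
        have "jumps n \<sigma> ! i = ?M ?p - ?M (?p - 1)"
          using i 2 p1 by (simp add: nth_jumps del: running_max.simps)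
        also have "\<dots> = ?r" using Mp max_prev[of k] k p by simp
        finally show ?thesis using 2 i by (simp add: nth_append)
      next
        case 3
        have "?M (Suc i) = ?M i"
          using max_const[OF k, of i] max_const[OF k, of "Suc i"] 3 i by simp
        then have "jumps n \<sigma> ! i = 0" using i by (simp add: nth_jumps del: running_max.simps)
        moreover have "(?r # replicate (?q - ?p - 1) 0) ! (i - (?p - 1)) = 0"
          using 3 i p1 by (cases "i - (?p - 1)") auto
        moreover have "\<not> i < ?p - 1" using 3 by simp
        ultimately show ?thesis using i pq q by (simp add: nth_append)
      qed
    next
      have "min (?q - 1) n = ?q - 1" "min (?p - 1) n = ?p - 1" using pq q by auto
      then show "length (take (?q - 1) (jumps n \<sigma>))
        = length (take (?p - 1) (jumps n \<sigma>) @ ?r # replicate (?q - ?p - 1) 0)"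
        using pq p1 by simp
    qed
    then have "block_path (take (?q - 1) (jumps n \<sigma>))
        = block_path (take (?p - 1) (jumps n \<sigma>)) @ replicate ?r U @ D # replicate (?q - ?p - 1) D"
      by (simp add: block_path_zeros)
    moreover have "?F (Suc k) = replicate ?r U @ D # replicate (?q - ?p - 1) D"
      by (simp add: lr_subword_def Let_def flip: ps_def) (simp add: next_pos_def)
    ultimately show ?case using Suc.IH k p by simp
  qed
  from this[of "length ps"] show ?thesis
    by (simp add: Psi_K_def next_pos_def flip: ps_def)
qed

section \<open>The bijection Phi on one-line notation\<close>

text \<open>The cyclic successor within a cycle written as a list.\<close>

definition cycle_next :: "'a list \<Rightarrow> nat \<Rightarrow> 'a" where
  "cycle_next b p = (if Suc p < length b then b ! Suc p else hd b)"

text \<open>Concatenate lists that each begin with their maximum, the maxima increasing. An element that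
  ends its list is followed by the larger head of the next list, and any other element by one that is
  at most the current head. Hence the cyclic successor is the minimum of the next letter and the
  current head, and the head is the running maximum of the word. This describes the cycles without
  reference to the block boundaries.\<close>

lemma nth_concat_blocks:
  fixes bs :: "'a :: linorder list list"
  assumes "\<And>b. b \<in> set bs \<Longrightarrow> b \<noteq> [] \<and> (\<forall>x\<in>set b. x \<le> hd b)"
    and "sorted_wrt (<) (map hd bs)" and "i < length (concat bs)"
  shows "\<exists>b\<in>set bs. \<exists>p<length b. concat bs ! i = b ! p \<and>
     cycle_next b p = (if Suc i < length (concat bs) then min (concat bs ! Suc i) (hd b) else hd b) \<and>
     hd b \<in> set (take (Suc i) (concat bs)) \<and> (\<forall>x\<in>set (take (Suc i) (concat bs)). x \<le> hd b)"
  using assms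
proof (induction bs rule: rev_induct)
  case Nil
  then show ?case by simp
next
  case (snoc c bs)
  let ?w = "concat bs"
  have c: "c \<noteq> []" "\<And>x. x \<in> set c \<Longrightarrow> x \<le> hd c" using snoc.prems(1) by auto
  have heads: "hd b < hd c" if "b \<in> set bs" for b
    using snoc.prems(2) that by (auto simp: sorted_wrt_append)
  show ?case
  proof (cases "i < length ?w")
    case True
    then obtain b p where bp: "b \<in> set bs" "p < length b" "?w ! i = b ! p"
      "cycle_next b p = (if Suc i < length ?w then min (?w ! Suc i) (hd b) else hd b)"
      "hd b \<in> set (take (Suc i) ?w)" "\<forall>x\<in>set (take (Suc i) ?w). x \<le> hd b"
      using snoc.IH snoc.prems(1,2) by (auto simp: sorted_wrt_append)
    have "cycle_next b p = (if Suc i < length (?w @ c) then min ((?w @ c) ! Suc i) (hd b) else hd b)"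
    proof (cases "Suc i < length ?w")
      case True
      then show ?thesis using bp(4) by (simp add: nth_append)
    next
      case False
      then have "Suc i = length ?w" using \<open>i < length ?w\<close> by simp
      then show ?thesis using bp(4) c heads[OF bp(1)] by (simp add: nth_append hd_conv_nth)
    qed
    moreover have "take (Suc i) (?w @ c) = take (Suc i) ?w" using True by simp
    ultimately show ?thesis using bp True
      by (intro bexI[of _ b] exI[of _ p]) (simp_all add: nth_append)
  next
    case False
    define p where "p = i - length ?w"
    have p: "p < length c" "i = length ?w + p" using False snoc.prems(3) by (auto simp: p_def)
    have "cycle_next c p = (if Suc i < length (?w @ c) then min ((?w @ c) ! Suc i) (hd c) else hd c)"
      using p c(2)[OF nth_mem, of "Suc p"] by (simp add: cycle_next_def nth_append)
    moreover have "hd c \<in> set (take (Suc i) (?w @ c))"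
      using c(1) p by (cases c) auto
    moreover have "x \<le> hd c" if "x \<in> set (take (Suc i) (?w @ c))" for x
    proof -
      have "x \<in> set ?w \<or> x \<in> set c" using that set_take_subset[of "Suc i" "?w @ c"] by auto
      then show ?thesis
      proof
        assume "x \<in> set ?w"
        then obtain b where "b \<in> set bs" "x \<in> set b" by auto
        then show ?thesis using heads[of b] snoc.prems(1)[of b] by fastforce
      qed (rule c(2))
    qed
    ultimately show ?thesis using p
      by (intro bexI[of _ c] exI[of _ p]) (simp_all add: nth_append)
  qed
qed

lemma permutation_of_perms: "\<tau> \<in> perms n \<Longrightarrow> permutation \<tau>"
  unfolding perms_def permutation_permutes by auto

lemma support_subset:
  assumes "\<tau> \<in> perms n" "a \<in> {1..n}"
  shows "set (support \<tau> a) \<subseteq> {1..n}"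
  using permutes_in_image[OF permutes_funpow[OF perms_D(1)[OF assms(1)]]] assms(2) by auto

lemma support_props:
  assumes "permutation \<tau>"
  shows "support \<tau> a \<noteq> []" "hd (support \<tau> a) = a" "a \<in> set (support \<tau> a)"
proof -
  have "0 < least_power \<tau> a" using least_power_of_permutation(2)[OF assms] .
  then show "support \<tau> a \<noteq> []" by simp
  then show hd: "hd (support \<tau> a) = a" by (simp add: hd_map)
  show "a \<in> set (support \<tau> a)" using \<open>support \<tau> a \<noteq> []\<close> hd hd_in_set by metis
qed

lemma cycle_next_support:
  assumes "permutation \<tau>" "p < length (support \<tau> a)"
  shows "cycle_next (support \<tau> a) p = \<tau> (support \<tau> a ! p)"
proof (cases "Suc p < least_power \<tau> a")
  case True
  then show ?thesis by (simp add: cycle_next_def)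
next
  case False
  then have "Suc p = least_power \<tau> a" using assms(2) by simp
  then have "\<tau> ((\<tau> ^^ p) a) = a"
    using least_power_of_permutation(1)[OF assms(1), of a] by (metis funpow.simps(2) comp_apply)
  then show ?thesis using False assms support_props(2)[OF assms(1)]
    by (simp add: cycle_next_def del: map_eq_Cons_conv)
qed

lemma finite_cycle_maxima: "finite (cycle_maxima n \<tau>)"
  by (simp add: cycle_maxima_def)

lemma support_eq_or_disjoint:
  assumes "permutation \<tau>" "x \<in> set (support \<tau> a)"
  shows "set (support \<tau> x) = set (support \<tau> a)"
proof -
  have "x \<in> set (support \<tau> x)" using support_props(3)[OF assms(1)] .
  then show ?thesis
    using disjointD[OF disjoint_support[OF assms(1)] rangeI rangeI, of x a] assms(2) by blast
qed

lemma set_concat_standard_cycles: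
  assumes \<tau>: "\<tau> \<in> perms n"
  shows "set (concat (standard_cycles n \<tau>)) = {1..n}"
proof
  have set_eq: "set (concat (standard_cycles n \<tau>)) = (\<Union>a\<in>cycle_maxima n \<tau>. set (support \<tau> a))"
    using finite_cycle_maxima by (simp add: standard_cycles_def)
  show "set (concat (standard_cycles n \<tau>)) \<subseteq> {1..n}"
    unfolding set_eq using support_subset[OF \<tau>] by (auto simp: cycle_maxima_def)
  show "{1..n} \<subseteq> set (concat (standard_cycles n \<tau>))"
  proof
    fix x assume x: "x \<in> {1..n}"
    have perm: "permutation \<tau>" using \<tau> by (rule permutation_of_perms)
    let ?a = "Max (set (support \<tau> x))"
    have a: "?a \<in> set (support \<tau> x)"
      using support_props(1)[OF perm] by (intro Max_in) auto
    have eq: "set (support \<tau> ?a) = set (support \<tau> x)"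
      by (rule support_eq_or_disjoint[OF perm a])
    have "?a \<in> {1..n}" using a support_subset[OF \<tau> x] by blast
    then have "?a \<in> cycle_maxima n \<tau>"
      unfolding cycle_maxima_def mem_Collect_eq eq by (intro conjI ballI Max_ge) simp_all
    moreover have "x \<in> set (support \<tau> ?a)"
      unfolding eq by (rule support_props(3)[OF perm])
    ultimately show "x \<in> set (concat (standard_cycles n \<tau>))"
      unfolding set_eq by blast
  qed
qed

lemma distinct_concat_standard_cycles:
  assumes \<tau>: "\<tau> \<in> perms n"
  shows "distinct (concat (standard_cycles n \<tau>))"
proof -
  have perm: "permutation \<tau>" using \<tau> by (rule permutation_of_perms)
  have disj: "set (support \<tau> a) \<inter> set (support \<tau> b) = {}"
    if "a \<in> cycle_maxima n \<tau>" "b \<in> cycle_maxima n \<tau>" "a \<noteq> b" for a b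
  proof (rule ccontr)
    assume "set (support \<tau> a) \<inter> set (support \<tau> b) \<noteq> {}"
    then have "set (support \<tau> a) = set (support \<tau> b)"
      using support_eq_or_disjoint[OF perm] by blast
    then have "a \<le> b" "b \<le> a"
      using that support_props(3)[OF perm] unfolding cycle_maxima_def by blast+
    then show False using that by simp
  qed
  have "inj_on (support \<tau>) (cycle_maxima n \<tau>)"
    by (rule inj_onI) (metis support_props(2)[OF perm])
  then have "distinct (standard_cycles n \<tau>)"
    using finite_cycle_maxima[of n \<tau>] by (simp add: standard_cycles_def distinct_map)
  moreover have "distinct b" if "b \<in> set (standard_cycles n \<tau>)" for b
    using that cycle_of_permutation[OF perm] finite_cycle_maxima[of n \<tau>]
    by (auto simp: standard_cycles_def)
  moreover have "set b \<inter> set c = {}"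
    if "b \<in> set (standard_cycles n \<tau>)" "c \<in> set (standard_cycles n \<tau>)" "b \<noteq> c" for b c
    using that disj finite_cycle_maxima[of n \<tau>] unfolding standard_cycles_def by fastforce
  ultimately show ?thesis by (simp add: distinct_concat)
qed

lemma length_concat_standard_cycles:
  "\<tau> \<in> perms n \<Longrightarrow> length (concat (standard_cycles n \<tau>)) = n"
  using distinct_card[OF distinct_concat_standard_cycles, of \<tau> n] set_concat_standard_cycles[of \<tau> n]
  by (simp only: card_atLeastAtMost diff_Suc_1)

lemma Phi_in_perms:
  assumes \<tau>: "\<tau> \<in> perms n"
  shows "Phi n \<tau> \<in> perms n"
proof -
  let ?w = "concat (standard_cycles n \<tau>)"
  have "bij_betw (\<lambda>i. i - 1) {1..n} {..<n}"
    by (rule bij_betw_byWitness[where f' = Suc]) auto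
  moreover have "bij_betw ((!) ?w) {..<n} {1..n}"
    by (rule bij_betw_nth[OF distinct_concat_standard_cycles[OF \<tau>]])
       (simp_all only: length_concat_standard_cycles[OF \<tau>] set_concat_standard_cycles[OF \<tau>])
  ultimately have "bij_betw ((!) ?w \<circ> (\<lambda>i. i - 1)) {1..n} {1..n}"
    by (rule bij_betw_trans)
  then have "bij_betw (Phi n \<tau>) {1..n} {1..n}"
    by (rule bij_betw_cong[THEN iffD1, rotated]) (auto simp: Phi_def)
  then show ?thesis
    unfolding perms_def mem_Collect_eq by (rule bij_imp_permutes) (simp only: Phi_def if_False)
qed

text \<open>The key property of the bijection: it recovers \<open>\<tau>\<close> from the one-line notation alone. For
  \<open>i = n\<close> the term \<open>Phi n \<tau> (Suc n) = Suc n\<close> exceeds all maxima, which closes the last cycle.\<close>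

lemma Phi_successor:
  assumes \<tau>: "\<tau> \<in> perms n" and i: "i \<in> {1..n}"
  shows "\<tau> (Phi n \<tau> i) = min (Phi n \<tau> (Suc i)) (running_max (Phi n \<tau>) i)"
proof -
  let ?bs = "standard_cycles n \<tau>" and ?\<sigma> = "Phi n \<tau>"
  let ?w = "concat ?bs"
  have perm: "permutation \<tau>" using \<tau> by (rule permutation_of_perms)
  have len: "length ?w = n" by (rule length_concat_standard_cycles[OF \<tau>])
  have set_bs: "set ?bs = support \<tau> ` cycle_maxima n \<tau>"
    using finite_cycle_maxima[of n \<tau>] by (simp add: standard_cycles_def)
  have "map hd ?bs = sorted_list_of_set (cycle_maxima n \<tau>)"
    using support_props(2)[OF perm] unfolding standard_cycles_def by (simp add: map_idI)
  then have sorted: "sorted_wrt (<) (map hd ?bs)" by simp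
  have blocks: "b \<noteq> [] \<and> (\<forall>x\<in>set b. x \<le> hd b)" if b: "b \<in> set ?bs" for b
  proof -
    obtain a where a: "a \<in> cycle_maxima n \<tau>" "b = support \<tau> a"
      using b unfolding set_bs image_iff by (rule bexE)
    then have "\<forall>x\<in>set b. x \<le> a" by (simp add: cycle_maxima_def)
    then show ?thesis using a support_props(1,2)[OF perm, of a] by metis
  qed
  have \<sigma>_nth: "?\<sigma> (Suc k) = ?w ! k" if "k < n" for k
    using that by (simp add: Phi_def)
  obtain j where j: "i = Suc j" "j < n" using i by (cases i) auto
  obtain b p where b: "b \<in> set ?bs" "p < length b" "?w ! j = b ! p"
    "cycle_next b p = (if Suc j < length ?w then min (?w ! Suc j) (hd b) else hd b)"
    "hd b \<in> set (take (Suc j) ?w)" "\<forall>x\<in>set (take (Suc j) ?w). x \<le> hd b"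
    using nth_concat_blocks[OF blocks sorted, of j] j(2) len by metis
  have take_eq: "set (take (Suc j) ?w) = ?\<sigma> ` {1..i}"
  proof -
    have "set (take (Suc j) ?w) = (!) ?w ` {..<Suc j}"
      using j len by (subst nth_image[symmetric]) (simp_all add: lessThan_atLeast0)
    also have "\<dots> = (\<lambda>k. ?\<sigma> (Suc k)) ` {..<Suc j}"
      using j by (intro image_cong refl) (simp add: \<sigma>_nth)
    also have "\<dots> = ?\<sigma> ` Suc ` {..<Suc j}" by (simp add: image_image)
    also have "Suc ` {..<Suc j} = {1..i}"
      using j by (simp add: image_Suc_lessThan)
    finally show ?thesis .
  qed
  obtain k where "k \<in> {1..i}" "?\<sigma> k = hd b"
    using b(5) unfolding take_eq by auto
  then have max: "running_max ?\<sigma> i = hd b"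
    using b(6) unfolding take_eq by (intro running_max_eqI) auto
  have "hd b \<in> {1..n}"
    using b(5) set_take_subset[of "Suc j" ?w] set_concat_standard_cycles[OF \<tau>] by blast
  obtain a where "b = support \<tau> a" using b(1) unfolding set_bs image_iff by (rule bexE)
  then have "\<tau> (?\<sigma> i) = cycle_next b p"
    using cycle_next_support[OF perm, of p a] b(2,3) \<sigma>_nth[OF j(2)] j(1) by simp
  also have "\<dots> = min (?\<sigma> (Suc i)) (hd b)"
  proof (cases "Suc j < n")
    case True
    then show ?thesis using b(4) len \<sigma>_nth[OF True] j(1) by simp
  next
    case False
    then have "?\<sigma> (Suc i) = Suc n" using j by (simp add: Phi_def)
    then show ?thesis using b(4) len False \<open>hd b \<in> {1..n}\<close> by simp
  qed
  finally show ?thesis unfolding max .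
qed

lemma inj_on_Phi: "inj_on (Phi n) (perms n)"
proof (rule inj_onI, rule ext)
  fix \<tau> \<rho> x
  assume \<tau>: "\<tau> \<in> perms n" and \<rho>: "\<rho> \<in> perms n" and eq: "Phi n \<tau> = Phi n \<rho>"
  show "\<tau> x = \<rho> x"
  proof (cases "x \<in> {1..n}")
    case True
    then obtain i where "i \<in> {1..n}" "x = Phi n \<tau> i"
      using permutes_image[OF perms_D(1)[OF Phi_in_perms[OF \<tau>]]] by blast
    then show ?thesis
      using Phi_successor[OF \<tau>] Phi_successor[OF \<rho>] eq by simp
  next
    case False
    then show ?thesis using perms_D(1)[OF \<tau>] perms_D(1)[OF \<rho>] by (simp add: permutes_def)
  qed
qed

text \<open>Injectivity on a finite set makes \<open>Phi n\<close> surjective, so \<open>hat n \<sigma>\<close> is a genuine preimage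
  of \<open>\<sigma>\<close>.\<close>

lemma hat_successor:
  assumes \<sigma>: "\<sigma> \<in> perms n" and i: "i \<in> {1..n}"
  shows "hat n \<sigma> (\<sigma> i) = min (\<sigma> (Suc i)) (running_max \<sigma> i)"
proof -
  have "finite (perms n)" unfolding perms_def by (simp add: finite_permutations)
  then have "Phi n ` perms n = perms n"
    using inj_on_Phi Phi_in_perms by (intro endo_inj_surj) auto
  with \<sigma> have "\<sigma> \<in> Phi n ` perms n" by simp
  then have "hat n \<sigma> \<in> perms n" "Phi n (hat n \<sigma>) = \<sigma>"
    unfolding hat_def by (rule inv_into_into, rule f_inv_into_f)
  then show ?thesis using Phi_successor[of "hat n \<sigma>" n i] i by simp
qed

section \<open>Occurrences of the arrow pattern\<close>

lemma beta_occurrence_iff: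
  "arrow_occurrence n \<sigma> beta_pattern X \<longleftrightarrow>
    (\<exists>i j. 1 \<le> i \<and> i < j \<and> j \<le> n \<and> \<sigma> i < \<sigma> j \<and> hat n \<sigma> (\<sigma> i) = \<sigma> j \<and>
           X = {\<sigma> i, \<sigma> j} \<and> X \<subseteq> {1..n})" (is "?L \<longleftrightarrow> ?R")
proof -
  let ?x = "\<lambda>a. sorted_list_of_set X ! a"
  have letters: "card (letters beta_pattern) = 2"
    by (simp add: letters_def beta_pattern_def card_insert_if)
  have expand: "?L \<longleftrightarrow> X \<subseteq> {1..n} \<and> card X = 2 \<and>
      (\<exists>ts. sorted_wrt (<) ts \<and> set ts \<subseteq> {1..n} \<and> map \<sigma> ts = [?x 0, ?x 1]) \<and>
      hat n \<sigma> (?x 0) = ?x 1"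
    unfolding arrow_occurrence_def letters by (simp add: beta_pattern_def Let_def)
  have pair: "?x 0 = x" "?x 1 = y" if "X = {x, y}" "x < y" for x y
    using that by simp_all
  show ?thesis
  proof
    assume ?L
    then have X: "X \<subseteq> {1..n}" "card X = 2" by (simp_all add: expand)
    then obtain x y where xy: "X = {x, y}" "x < y"
      by (metis card_2_iff insert_commute linorder_neqE_nat)
    obtain ts where ts: "sorted_wrt (<) ts" "set ts \<subseteq> {1..n}" "map \<sigma> ts = [x, y]"
      and hat: "hat n \<sigma> x = y"
      using \<open>?L\<close> unfolding expand pair[OF xy] by metis
    obtain i j where ij: "ts = [i, j]" "\<sigma> i = x" "\<sigma> j = y" using ts(3) by auto
    have "1 \<le> i" "i < j" "j \<le> n" using ts(1,2) ij(1) by auto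
    moreover have "\<sigma> i < \<sigma> j" "hat n \<sigma> (\<sigma> i) = \<sigma> j" "X = {\<sigma> i, \<sigma> j}"
      unfolding ij(2,3) using hat xy by simp_all
    ultimately show ?R using X(1) by blast
  next
    assume ?R
    then obtain i j where ij: "1 \<le> i" "i < j" "j \<le> n" "\<sigma> i < \<sigma> j" "hat n \<sigma> (\<sigma> i) = \<sigma> j"
      "X = {\<sigma> i, \<sigma> j}" "X \<subseteq> {1..n}" by blast
    have "\<exists>ts. sorted_wrt (<) ts \<and> set ts \<subseteq> {1..n} \<and> map \<sigma> ts = [\<sigma> i, \<sigma> j]"
      using ij(1-3) by (intro exI[of _ "[i, j]"]) simp
    moreover have "card X = 2" using ij(4,6) by simp
    ultimately show ?L
      unfolding expand pair[OF ij(6,4)] using ij(5,7) by blast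
  qed
qed

text \<open>The successor \<open>min (\<sigma> (Suc i)) (running_max \<sigma> i)\<close> of \<open>\<sigma> i\<close> has to lie to the right of
  position \<open>i\<close>. The running maximum does not, so the successor is the next letter.\<close>

lemma beta_occurrences:
  assumes \<sigma>: "\<sigma> \<in> perms n"
  shows "{X. arrow_occurrence n \<sigma> beta_pattern X} =
    (\<lambda>i. {\<sigma> i, \<sigma> (Suc i)}) `
      {i \<in> {1..<n}. \<sigma> i < \<sigma> (Suc i) \<and> \<sigma> (Suc i) < running_max \<sigma> i}" (is "_ = _ ` ?S")
proof (intro equalityI subsetI)
  fix X assume "X \<in> {X. arrow_occurrence n \<sigma> beta_pattern X}"
  then obtain i j where ij: "1 \<le> i" "i < j" "j \<le> n" "\<sigma> i < \<sigma> j" "hat n \<sigma> (\<sigma> i) = \<sigma> j"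
    "X = {\<sigma> i, \<sigma> j}"
    by (auto simp: beta_occurrence_iff)
  then have j: "\<sigma> j = min (\<sigma> (Suc i)) (running_max \<sigma> i)"
    using hat_successor[OF \<sigma>, of i] by simp
  have "\<sigma> j \<noteq> running_max \<sigma> i"
  proof
    assume eq: "\<sigma> j = running_max \<sigma> i"
    then have "running_max \<sigma> i \<noteq> 0" using ij(4) by simp
    then obtain k where "k \<in> {1..i}" "\<sigma> j = \<sigma> k"
      using running_max_attained[of \<sigma> i] eq by auto
    then show False using injD[OF perms_D(2)[OF \<sigma>], of j k] ij(2) by simp
  qed
  with j have "\<sigma> j = \<sigma> (Suc i)" "\<sigma> (Suc i) < running_max \<sigma> i" by (auto simp: min_def split: if_splits)
  with ij show "X \<in> (\<lambda>i. {\<sigma> i, \<sigma> (Suc i)}) ` ?S" by auto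
next
  fix X assume "X \<in> (\<lambda>i. {\<sigma> i, \<sigma> (Suc i)}) ` ?S"
  then obtain i where i: "i \<in> {1..<n}" "\<sigma> i < \<sigma> (Suc i)" "\<sigma> (Suc i) < running_max \<sigma> i"
    "X = {\<sigma> i, \<sigma> (Suc i)}" by blast
  then have "hat n \<sigma> (\<sigma> i) = \<sigma> (Suc i)" using hat_successor[OF \<sigma>, of i] by simp
  moreover have "X \<subseteq> {1..n}"
    using i perms_D(3)[OF \<sigma>, of i] perms_D(3)[OF \<sigma>, of "Suc i"] by auto
  ultimately show "X \<in> {X. arrow_occurrence n \<sigma> beta_pattern X}"
    using i unfolding beta_occurrence_iff mem_Collect_eq
    by (intro exI[of _ i] exI[of _ "Suc i"]) auto
qed

lemma finite_beta_occurrences: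
  "finite {X. arrow_occurrence n \<sigma> beta_pattern X}"
proof (rule finite_subset)
  show "{X. arrow_occurrence n \<sigma> beta_pattern X} \<subseteq> Pow {1..n}"
    unfolding arrow_occurrence_def by blast
qed simp

text \<open>Under 321-avoidance the condition \<open>\<sigma> i < \<sigma> (Suc i)\<close> is automatic once both positions are
  non-records.\<close>

lemma arrow_count_beta:
  assumes \<sigma>: "\<sigma> \<in> perms_avoiding_321 n"
  shows "arrow_count n beta_pattern \<sigma> = zero_pairs (jumps n \<sigma>)"
proof -
  let ?S = "{i \<in> {1..<n}. \<sigma> i < \<sigma> (Suc i) \<and> \<sigma> (Suc i) < running_max \<sigma> i}"
  let ?Z = "{i. Suc i < length (jumps n \<sigma>) \<and> jumps n \<sigma> ! i = 0 \<and> jumps n \<sigma> ! Suc i = 0}"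
  have perm: "\<sigma> \<in> perms n" using \<sigma> by (simp add: mem_perms_avoiding_321_iff)
  have "inj_on (\<lambda>i. {\<sigma> i, \<sigma> (Suc i)}) ?S"
  proof (rule inj_onI)
    fix i j assume i: "i \<in> ?S" and j: "j \<in> ?S" and "{\<sigma> i, \<sigma> (Suc i)} = {\<sigma> j, \<sigma> (Suc j)}"
    moreover have "\<sigma> i < \<sigma> (Suc i)" "\<sigma> j < \<sigma> (Suc j)" using i j by simp_all
    ultimately have "\<sigma> i = \<sigma> j" unfolding doubleton_eq_iff by linarith
    then show "i = j" by (rule injD[OF perms_D(2)[OF perm]])
  qed
  then have "arrow_count n beta_pattern \<sigma> = card ?S"
    unfolding arrow_count_def beta_occurrences[OF perm] by (rule card_image)
  also have "?S = Suc ` ?Z"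
  proof (intro equalityI subsetI)
    fix i assume i: "i \<in> ?S"
    then obtain m where m: "i = Suc m" by (cases i) auto
    have "\<sigma> i < running_max \<sigma> i" "\<sigma> (Suc i) < running_max \<sigma> (Suc i)"
      using i by simp_all
    then have "m \<in> ?Z"
      using i m jumps_eq_0_iff[OF perm, of m] jumps_eq_0_iff[OF perm, of i] by simp
    then show "i \<in> Suc ` ?Z" using m by blast
  next
    fix i assume "i \<in> Suc ` ?Z"
    then obtain m where m: "i = Suc m" "i < n" "jumps n \<sigma> ! m = 0" "jumps n \<sigma> ! i = 0" by auto
    then have less: "\<sigma> i < running_max \<sigma> i" "\<sigma> (Suc i) < running_max \<sigma> (Suc i)"
      using jumps_eq_0_iff[OF perm, of m] jumps_eq_0_iff[OF perm, of i] by auto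
    have "\<sigma> i < \<sigma> (Suc i)"
      using nonrecords_increasing[OF \<sigma> _ _ _ less(1), of "Suc i"] m by simp
    moreover have "\<sigma> (Suc i) < running_max \<sigma> i"
      using less(2) by (auto simp: max_def split: if_splits)
    ultimately show "i \<in> ?S" using m by simp
  qed
  also have "card (Suc ` ?Z) = zero_pairs (jumps n \<sigma>)"
    by (simp add: zero_pairs_def card_image)
  finally show ?thesis .
qed

section \<open>The bijection and its consequences\<close>

lemma Psi_eq: "\<sigma> \<in> perms_avoiding_321 n \<Longrightarrow> Psi n \<sigma> = rev_path (block_path (jumps n \<sigma>))"
  by (simp add: Psi_def Psi_K_eq_block_path_jumps mem_perms_avoiding_321_iff)

lemma bij_betw_Psi: "bij_betw (Psi n) (perms_avoiding_321 n) (dyck_paths n)"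
proof -
  have "bij_betw (rev_path \<circ> (block_path \<circ> jumps n)) (perms_avoiding_321 n) (dyck_paths n)"
    using bij_betw_jumps bij_betw_block_path bij_betw_rev_path by (blast intro: bij_betw_trans)
  then show ?thesis
    by (rule bij_betw_cong[THEN iffD2, rotated]) (simp add: Psi_eq)
qed

lemma arrow_count_eq_tu:
  assumes \<sigma>: "\<sigma> \<in> perms_avoiding_321 n"
  shows "arrow_count n beta_pattern \<sigma> = tu (Psi n \<sigma>)"
proof -
  have perm: "\<sigma> \<in> perms n" using \<sigma> by (simp add: mem_perms_avoiding_321_iff)
  have "hd (jumps n \<sigma>) > 0" if "jumps n \<sigma> \<noteq> []"
  proof -
    have "0 < n" using that by (cases n) (auto simp: jumps_def)
    then show ?thesis
      using that perms_D(3)[OF perm, of 1] by (simp add: hd_conv_nth nth_jumps)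
  qed
  then show ?thesis
    using arrow_count_beta[OF \<sigma>] tu_rev_path_block_path[of "jumps n \<sigma>"] Psi_eq[OF \<sigma>] by simp
qed

theorem theorem4p6:
  fixes n :: nat
  assumes "n \<ge> 1"
  shows "bij_betw (Psi n) (perms_avoiding_321 n) (dyck_paths n)
       \<and> (\<forall>\<sigma> \<in> perms_avoiding_321 n. arrow_count n beta_pattern \<sigma> = tu (Psi n \<sigma>))
       \<and> card {\<sigma> \<in> perms_avoiding_321 n. avoids_arrow n beta_pattern \<sigma>}
           = card {w \<in> dyck_paths n. tu w = 0}
       \<and> card {w \<in> dyck_paths n. tu w = 0} = motzkin_number n"
proof (intro conjI ballI)
  have avoids_iff: "avoids_arrow n beta_pattern \<sigma> \<longleftrightarrow> tu (Psi n \<sigma>) = 0"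
    if "\<sigma> \<in> perms_avoiding_321 n" for \<sigma>
    using arrow_count_eq_tu[OF that] finite_beta_occurrences[of n \<sigma>]
    by (auto simp: arrow_count_def avoids_arrow_def card_eq_0_iff simp flip: arrow_count_eq_tu[OF that])
  have "bij_betw (Psi n) {\<sigma> \<in> perms_avoiding_321 n. avoids_arrow n beta_pattern \<sigma>}
      {w \<in> dyck_paths n. tu w = 0}"
    by (rule bij_betw_Collect[OF bij_betw_Psi]) (simp add: avoids_iff)
  then show "card {\<sigma> \<in> perms_avoiding_321 n. avoids_arrow n beta_pattern \<sigma>}
           = card {w \<in> dyck_paths n. tu w = 0}"
    by (rule bij_betw_same_card)
qed (fact bij_betw_Psi arrow_count_eq_tu card_tu_free_eq_motzkin)+

end
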